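(* Let $\ell\in\mathbb{R}$. The function $g_{H_\ell}(t):=H_\ell(e^t)-H_\ell(1)$ $(t\in\mathbb{R})$ is a screw function on $\mathbb{R}$ if and only if the Riemann hypothesis holds.
   Context: For $\ell\in\mathbb{R}$ and $X>0$, $H_\ell(X):=\sum_{\rho}\frac{X^{\rho-1/2}}{(\rho-\ell)((1-\rho)-\ell)}$, where the (absolutely convergent) sum runs over all nontrivial zeros $\rho$ of the Riemann zeta function $\zeta(s)$ (zeros with $0<\Re(\rho)<1$), counted with multiplicity. The Riemann hypothesis asserts $\Re(\rho)=1/2$ for all nontrivial zeros. A continuous function $g:\mathbb{R}\to\mathbb{C}$ is called a screw function on $\mathbb{R}$ if $g(-t)=\overline{g(t)}$ for all $t\in\mathbb{R}$ and the kernel $G_g(t,u):=g(t-u)-g(t)-g(-u)+g(0)$ is nonnegative definite on $\mathbb{R}\times\mathbb{R}$, i.e. $\sum_{i,j=1}^n G_g(t_i,t_j)\,\xi_i\overline{\xi_j}\ge 0$ for all $n\in\mathbb{Z}_{>0}$, $t_i\in\mathbb{R}$, $\xi_i\in\mathbb{C}$. *)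

theory Defs
  imports "HOL-Complex_Analysis.Complex_Analysis"
begin

(* The unique holomorphic continuation of the Dirichlet series to the plane punctured at 1.
   The clause f 1 = 0 only fixes the otherwise arbitrary value at the pole, so that the
   function is determined on the whole type. *)
definition riemann_zeta :: "complex \<Rightarrow> complex" where
  "riemann_zeta = (THE f. f holomorphic_on (- {1}) \<and>
     (\<forall>s. Re s > 1 \<longrightarrow> f s = (\<Sum>n. 1 / of_nat (Suc n) powr s)) \<and> f 1 = 0)"

definition nontrivial_zeros :: "complex set" where
  "nontrivial_zeros = {\<rho>. riemann_zeta \<rho> = 0 \<and> 0 < Re \<rho> \<and> Re \<rho> < 1}"

definition riemann_hypothesis :: bool where
  "riemann_hypothesis \<longleftrightarrow> (\<forall>\<rho>\<in>nontrivial_zeros. Re \<rho> = 1 / 2)"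

(* Meaningful for X > 0. The multiplicity of a zero is its order zorder; infsum is
   unconditional, i.e. absolute, summation. *)
definition H :: "real \<Rightarrow> real \<Rightarrow> complex" where
  "H l X = (\<Sum>\<^sub>\<infinity>\<rho>\<in>nontrivial_zeros. of_int (zorder riemann_zeta \<rho>) *
     (of_real X powr (\<rho> - 1 / 2) / ((\<rho> - of_real l) * ((1 - \<rho>) - of_real l))))"

definition screw_kernel :: "(real \<Rightarrow> complex) \<Rightarrow> real \<Rightarrow> real \<Rightarrow> complex" where
  "screw_kernel g t u = g (t - u) - g t - g (- u) + g 0"

definition nonneg_definite_kernel :: "(real \<Rightarrow> real \<Rightarrow> complex) \<Rightarrow> bool" where
  "nonneg_definite_kernel K \<longleftrightarrow> (\<forall>n>0. \<forall>(t :: nat \<Rightarrow> real) (\<xi> :: nat \<Rightarrow> complex).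
     (\<Sum>i<n. \<Sum>j<n. K (t i) (t j) * \<xi> i * cnj (\<xi> j)) \<in> \<real>\<^sub>\<ge>\<^sub>0)"

definition screw_function :: "(real \<Rightarrow> complex) \<Rightarrow> bool" where
  "screw_function g \<longleftrightarrow> continuous_on UNIV g \<and> (\<forall>t. g (- t) = cnj (g t)) \<and>
     nonneg_definite_kernel (screw_kernel g)"

end

(* H l (exp t) is an absolutely convergent exponential sum with exponents rho - 1/2. Under the
   Riemann hypothesis the exponents are imaginary and the coefficients are m / |rho - l|^2 >= 0, so
   the kernel is a positive combination of the rank-one kernels (e^(i gamma t) - 1) * cnj (e^(i gamma u) - 1).

   Conversely, positivity of the kernel gives q (2 t) <= 4 q t for q t = - 2 Re (g t), hence quadratic
   growth of g t + g (- t). The Laplace transform of this function is then holomorphic for Re z > 0,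
   while it equals a sum of c w / (z - w) over w = rho - 1/2 and w = 1/2 - rho, up to a multiple
   of 1 / z. So no such w lies in the right half-plane. Symmetrising in t makes the functional
   equation unnecessary: the coefficients of rho and 1 - rho have the same denominator and cannot
   cancel, and the denominator is nonzero because zeta has no zeros in the real interval (0, 1).

   Absolute convergence needs O(log T) zeros at height T, which follows from polynomial growth in
   vertical strips of the entire function eta s = (1 - 2 powr (1 - s)) * zeta s. *)
theory Submission
  imports Defs
begin

section \<open>The Dirichlet eta function as an entire function\<close>

text \<open>\<open>riemann_zeta\<close> is a definite description, so its continuation has to be
  constructed before its zeros can be discussed. Dividing \<open>eta\<close> by
  \<open>1 - 2 powr (1 - s)\<close> does not settle the line \<open>Re s = 1\<close>, where the
  divisor vanishes at infinitely many points; a second formula, valid for \<open>Re s > 0\<close>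
  away from 1, bridges that line. In the critical strip the divisor is zero-free, so multiplicities
  can be counted for the entire function \<open>eta\<close>. Counting zeros near height
  \<open>T\<close> from the centre \<open>2 + i T\<close> uses a circle that reaches
  \<open>Re s = -4.3\<close>; the growth of \<open>eta\<close> is therefore needed well to the left
  of the strip, and differences of high order supply it. In the converse, the exponents form an
  infinite set, so the transform is compared with its pole sum on bounded half-discs, each of which
  meets only finitely many poles.\<close>

lemma holomorphic_suminf:
  fixes f :: "nat \<Rightarrow> complex \<Rightarrow> complex"
  assumes "open S" and hol: "\<And>n. f n holomorphic_on S"
    and bd: "\<And>x. x \<in> S \<Longrightarrow> \<exists>d>0. \<exists>M. summable M \<and> (\<forall>n. \<forall>y\<in>ball x d \<inter> S. norm (f n y) \<le> M n)"
  shows "(\<lambda>s. \<Sum>n. f n s) holomorphic_on S"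
proof -
  have cmp: "\<exists>d h. 0 < d \<and> summable h \<and> range h \<subseteq> \<real>\<^sub>\<ge>\<^sub>0 \<and>
      (\<forall>\<^sub>F n in sequentially. \<forall>y\<in>ball x d \<inter> S. cmod (f n y) \<le> cmod (h n))" if x: "x \<in> S" for x
  proof -
    obtain d M where d: "d > 0" "summable M" and M: "\<And>n y. y \<in> ball x d \<inter> S \<Longrightarrow> norm (f n y) \<le> M n"
      using bd[OF x] by blast
    have "M n \<ge> 0" for n
      using M[of x n] x d(1) norm_ge_zero[of "f n x"] by (simp del: norm_ge_zero)
    hence "range (\<lambda>n. complex_of_real (M n)) \<subseteq> \<real>\<^sub>\<ge>\<^sub>0"
      "\<And>n. cmod (complex_of_real (M n)) = M n"
      by (auto simp: complex_nonneg_Reals_iff)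
    thus ?thesis using d M
      by (intro exI[of _ d] exI[of _ "\<lambda>n. complex_of_real (M n)"] conjI always_eventually)
        (simp_all add: summable_of_real)
  qed
  have fd: "f n field_differentiable (at x)" if "x \<in> S" for n x
    using holomorphic_on_imp_differentiable_at[OF hol \<open>open S\<close> that] .
  obtain g where g: "\<forall>x\<in>S. ((\<lambda>n. f n x) sums g x) \<and> g field_differentiable (at x)"
    by (rule series_differentiable_comparison_complex[OF \<open>open S\<close> fd cmp])
  hence "g holomorphic_on S"
    by (auto simp: holomorphic_on_def intro: field_differentiable_at_within)
  thus ?thesis
    by (rule holomorphic_transform) (use g in \<open>auto simp: sums_iff\<close>)
qed

section \<open>Iterated differences of powers and Euler's transformation\<close>

lemma has_vector_derivative_of_real_powr:
  fixes s :: complex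
  assumes "x > 0"
  shows "((\<lambda>x. of_real x powr s) has_vector_derivative s * of_real x powr (s - 1)) (at x)"
proof -
  have "((\<lambda>z. z powr s) has_field_derivative s * of_real x powr (s - 1)) (at (of_real x))"
    using assms by (auto intro!: derivative_eq_intros simp: complex_nonpos_Reals_iff)
  thus ?thesis by (rule has_vector_derivative_real_field)
qed

text \<open>With \<open>E\<close> the shift of \<open>x\<close> by one, this is
  \<open>(1 - E) ^ k\<close> applied to \<open>x powr (- s)\<close>, in the sign convention of
  Euler's transformation of alternating series.\<close>

primrec dif :: "nat \<Rightarrow> complex \<Rightarrow> real \<Rightarrow> complex" where
  "dif 0 s x = of_real x powr (- s)"
| "dif (Suc k) s x = dif k s x - dif k s (x + 1)"

text \<open>Differentiation in \<open>x\<close> commutes with the shift, so every order inherits the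
  rule for \<open>x powr (- s)\<close>.\<close>

lemma dif_has_vector_derivative:
  "x > 0 \<Longrightarrow> (dif k s has_vector_derivative - s * dif k (s + 1) x) (at x)"
proof (induction k arbitrary: x)
  case 0
  show ?case using has_vector_derivative_of_real_powr[OF 0, of "- s"]
    by (simp add: fun_eq_iff)
next
  case (Suc k)
  have "((dif k s \<circ> (\<lambda>x. x + 1)) has_vector_derivative (1::real) *\<^sub>R (- s * dif k (s + 1) (x + 1))) (at x)"
    using Suc.prems Suc.IH[of "x + 1"]
    by (intro vector_diff_chain_at) (auto intro!: derivative_eq_intros)
  from has_vector_derivative_diff[OF Suc.IH[OF Suc.prems] this] show ?case
    by (simp add: o_def algebra_simps fun_eq_iff)
qed

text \<open>A difference is an increment over a unit interval, so one mean value inequality per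
  order trades it for a factor \<open>s\<close> and the parameter \<open>s + 1\<close>. The
  condition on \<open>Re s + k\<close> keeps the exponent nonpositive, which allows the intermediate
  point to be moved back to \<open>x\<close>.\<close>

lemma norm_dif_le:
  assumes "x \<ge> 1" "Re s + k \<ge> 0"
  shows "norm (dif k s x) \<le> (\<Prod>j<k. norm (s + of_nat j)) * x powr (- Re s - k)"
  using assms
proof (induction k arbitrary: s x)
  case 0
  thus ?case by (simp add: norm_powr_real_powr)
next
  case (Suc k)
  have "\<exists>y\<in>{x<..<x+1}. norm (dif k s (x + 1) - dif k s x)
      \<le> norm ((\<lambda>h. h *\<^sub>R (- s * dif k (s + 1) y)) (x + 1 - x))"
  proof (rule mvt_general)
    show "continuous_on {x..x + 1} (dif k s)"
      using Suc.prems by (intro continuous_at_imp_continuous_on ballI)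
        (auto intro!: has_vector_derivative_continuous[OF dif_has_vector_derivative])
  next
    fix y assume "x < y" "y < x + 1"
    thus "(dif k s has_derivative (\<lambda>h. h *\<^sub>R (- s * dif k (s + 1) y))) (at y)"
      using Suc.prems dif_has_vector_derivative[of y k s] by (simp add: has_vector_derivative_def)
  qed simp
  then obtain y where y: "x < y" "y < x + 1" "norm (dif k s (x + 1) - dif k s x) \<le> norm s * norm (dif k (s + 1) y)"
    by (auto simp: norm_mult)
  have "norm (dif k (s + 1) y) \<le> (\<Prod>j<k. norm (s + 1 + of_nat j)) * y powr (- Re (s + 1) - k)"
    using Suc.prems y by (intro Suc.IH) auto
  also have "\<dots> \<le> (\<Prod>j<k. norm (s + 1 + of_nat j)) * x powr (- Re (s + 1) - k)"
    using Suc.prems y by (intro mult_left_mono powr_mono2' prod_nonneg) auto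
  finally have "norm (dif (Suc k) s x) \<le> norm s * ((\<Prod>j<k. norm (s + 1 + of_nat j)) * x powr (- Re (s + 1) - k))"
    using y(3) by (simp add: norm_minus_commute) (meson mult_left_mono norm_ge_zero order_trans)
  also have "\<dots> = (\<Prod>j<Suc k. norm (s + of_nat j)) * x powr (- Re s - Suc k)"
    unfolding prod.lessThan_Suc_shift by (simp add: add.assoc diff_diff_eq add.commute[of 1])
  finally show ?case .
qed

lemma summable_Suc_powr: "a < -1 \<Longrightarrow> summable (\<lambda>n. real (Suc n) powr a)"
  using summable_real_powr_iff[of a] summable_Suc_iff[of "\<lambda>n. real n powr a"] by simp

lemma norm_dif_le_of_bounds:
  assumes "norm s \<le> R" "\<sigma> \<le> Re s" "\<sigma> + k \<ge> 0" "x \<ge> 1"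
  shows "norm (dif k s x) \<le> (R + k) ^ k * x powr (- \<sigma> - k)"
proof -
  have "(\<Prod>j<k. norm (s + of_nat j)) \<le> (\<Prod>j<k. R + k)"
  proof (intro prod_mono conjI norm_ge_zero)
    fix j assume "j \<in> {..<k}"
    thus "norm (s + of_nat j) \<le> R + k"
      using norm_triangle_ineq[of s "of_nat j"] assms(1) by simp
  qed
  moreover have "x powr (- Re s - k) \<le> x powr (- \<sigma> - k)"
    using assms by (intro powr_mono) auto
  ultimately have "(\<Prod>j<k. norm (s + of_nat j)) * x powr (- Re s - k) \<le> (R + k) ^ k * x powr (- \<sigma> - k)"
    using assms(1) norm_ge_zero[of s] by (intro mult_mono) (auto intro: zero_le_power simp del: norm_ge_zero)
  thus ?thesis using norm_dif_le[of x s k] assms by auto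
qed

definition alt_dif_sum :: "nat \<Rightarrow> complex \<Rightarrow> complex" where
  "alt_dif_sum k s = (\<Sum>n. (-1) ^ n * dif k s (real (Suc n)))"

lemma summable_alt_dif:
  assumes "Re s + k > 1"
  shows "summable (\<lambda>n. (-1) ^ n * dif k s (real (Suc n)))"
proof (rule summable_comparison_test')
  show "summable (\<lambda>n. (norm s + k) ^ k * real (Suc n) powr (- Re s - k))"
    using assms by (intro summable_mult summable_Suc_powr) auto
  show "norm ((-1) ^ n * dif k s (real (Suc n))) \<le> (norm s + k) ^ k * real (Suc n) powr (- Re s - k)" for n
    using norm_dif_le_of_bounds[of s "norm s" "Re s" k "real (Suc n)"] assms by (simp add: norm_mult norm_power)
qed

lemma dif_holomorphic: "x > 0 \<Longrightarrow> (\<lambda>s. dif k s x) holomorphic_on A"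
proof (induction k arbitrary: x)
  case 0
  show ?case by (simp, intro holomorphic_intros)
next
  case (Suc k)
  thus ?case by (simp, intro holomorphic_on_diff) auto
qed

lemma alt_dif_sum_holomorphic: "alt_dif_sum k holomorphic_on {s. Re s + k > 1}"
  unfolding alt_dif_sum_def[abs_def]
proof (rule holomorphic_suminf)
  show "open {s. Re s + k > 1}"
    by (intro open_Collect_less continuous_intros)
  show "(\<lambda>s. (-1) ^ n * dif k s (real (Suc n))) holomorphic_on {s. Re s + k > 1}" for n
    by (intro holomorphic_intros dif_holomorphic) auto
next
  fix x assume "x \<in> {s. Re s + k > 1}"
  hence x: "Re x + k > 1" by simp
  define d where "d = (Re x + k - 1) / 2"
  have d: "d > 0" using x by (simp add: d_def)
  define M where "M = (\<lambda>n. (norm x + d + k) ^ k * real (Suc n) powr (- (Re x - d) - k))"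
  have "summable M" unfolding M_def
    using x by (intro summable_mult summable_Suc_powr) (auto simp: d_def field_simps)
  moreover have "norm ((-1) ^ n * dif k y (real (Suc n))) \<le> M n" if "y \<in> ball x d" for n y
  proof -
    have "norm (y - x) < d" using that by (simp add: dist_norm norm_minus_commute)
    hence "norm y \<le> norm x + d" "Re x - d \<le> Re y"
      using norm_triangle_sub[of y x] abs_Re_le_cmod[of "y - x"] by auto
    thus ?thesis using norm_dif_le_of_bounds[of y "norm x + d" "Re x - d" k "real (Suc n)"] x
      by (simp add: norm_mult norm_power M_def d_def field_simps)
  qed
  ultimately show "\<exists>d>0. \<exists>M. summable M \<and> (\<forall>n. \<forall>y\<in>ball x d \<inter> {s. Re s + k > 1}.
      norm ((-1) ^ n * dif k y (real (Suc n))) \<le> M n)"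
    using d by blast
qed

text \<open>Adding the series to its own shift by one index pairs neighbouring terms into
  differences of the next order. The shifted series is the original one without its first term, so
  twice the sum is that term plus the sum of order \<open>Suc k\<close>.\<close>

lemma alt_dif_sum_step:
  assumes "Re s + k > 1"
  shows "alt_dif_sum k s = dif k s 1 / 2 + alt_dif_sum (Suc k) s / 2"
proof -
  let ?f = "\<lambda>n. (-1) ^ n * dif k s (real (Suc n))"
  have S: "summable ?f" by (rule summable_alt_dif[OF assms])
  hence "alt_dif_sum k s + (\<Sum>n. ?f (Suc n)) = (\<Sum>n. ?f n + ?f (Suc n))"
    unfolding alt_dif_sum_def by (intro suminf_add) (use S summable_Suc_iff[of ?f] in auto)
  also have "\<dots> = alt_dif_sum (Suc k) s"
    unfolding alt_dif_sum_def by (intro arg_cong[where f = suminf]) (auto simp: fun_eq_iff algebra_simps)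
  finally have "alt_dif_sum k s + (\<Sum>n. ?f (Suc n)) = alt_dif_sum (Suc k) s" .
  moreover have "(\<Sum>n. ?f (Suc n)) = alt_dif_sum k s - dif k s 1"
    using suminf_split_head[OF S] by (simp add: alt_dif_sum_def)
  ultimately show ?thesis by (simp only:) (simp add: field_simps)
qed

text \<open>Repeated averaging of the alternating series \<open>\<Sum>n. (-1)^n (n+1)^(-s)\<close> accelerates it:
  \<open>eta_at k\<close> continues its sum to the half-plane \<open>Re s > 1 - k\<close>.\<close>

definition eta_at :: "nat \<Rightarrow> complex \<Rightarrow> complex" where
  "eta_at k s = (\<Sum>j<k. dif j s 1 / 2 ^ Suc j) + alt_dif_sum k s / 2 ^ k"

text \<open>Every order \<open>k\<close> with \<open>Re s + k > 1\<close> yields the same value;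
  this choice guarantees \<open>Re s + k \<ge> 2\<close>.\<close>

definition eta :: "complex \<Rightarrow> complex" where
  "eta s = eta_at (nat \<lceil>2 - Re s\<rceil>) s"

lemma eta_at_mono:
  assumes "Re s + k > 1" "k \<le> m"
  shows "eta_at m s = eta_at k s"
  using assms(2)
proof (induction m rule: dec_induct)
  case (step m)
  have "eta_at (Suc m) s = eta_at m s"
    using alt_dif_sum_step[of s m] assms(1) step.hyps by (simp add: eta_at_def divide_simps)
  thus ?case using step by simp
qed simp

lemma eta_eq:
  assumes "Re s + k > 1"
  shows "eta s = eta_at k s"
proof -
  define m where "m = nat \<lceil>2 - Re s\<rceil>"
  have "Re s + m > 1" unfolding m_def by linarith
  thus ?thesis
    using eta_at_mono[of s m "max m k"] eta_at_mono[of s k "max m k"] assms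
    unfolding eta_def m_def[symmetric] by simp
qed

lemma eta_holomorphic: "eta holomorphic_on A"
proof -
  have "eta field_differentiable (at s)" for s
  proof -
    \<comment> \<open>The order in the definition of \<open>eta\<close> jumps with
      \<open>Re s\<close>. Frozen at the value for the point in question, it gives one formula on an
      open half-plane around that point.\<close>
    define k where "k = nat \<lceil>2 - Re s\<rceil>"
    let ?S = "{s. Re s + k > 1}"
    have s: "s \<in> ?S" unfolding k_def by simp linarith
    have "eta_at k holomorphic_on ?S" unfolding eta_at_def[abs_def]
      by (intro holomorphic_intros alt_dif_sum_holomorphic dif_holomorphic) auto
    hence "eta holomorphic_on ?S"
      by (rule holomorphic_transform) (use eta_eq in auto)
    moreover have "open ?S" by (intro open_Collect_less continuous_intros)
    ultimately show ?thesis using s holomorphic_on_imp_differentiable_at by blast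
  qed
  thus ?thesis
    by (simp add: holomorphic_on_def field_differentiable_at_within)
qed

section \<open>The zeta function\<close>

lemma of_real_powr_eq_exp: "x > 0 \<Longrightarrow> complex_of_real x powr z = exp (z * of_real (ln x))"
  by (simp add: powr_def Ln_of_real)

lemma norm_of_real_powr: "x > 0 \<Longrightarrow> norm (complex_of_real x powr z) = x powr Re z"
  by (simp add: norm_powr_real_powr)

lemma summable_dirichlet:
  assumes "Re s > 1"
  shows "summable (\<lambda>n. complex_of_real (real (Suc n)) powr (- s))"
proof (rule summable_comparison_test')
  show "summable (\<lambda>n. real (Suc n) powr (- Re s))"
    using assms by (intro summable_Suc_powr) auto
  show "norm (complex_of_real (real (Suc n)) powr (- s)) \<le> real (Suc n) powr (- Re s)" for n
    by (subst norm_of_real_powr) auto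
qed

text \<open>Subtracting twice the terms at even integers turns the zeta series into the alternating
  one, and those terms sum to \<open>2 powr (- s)\<close> times the whole.\<close>

lemma alt_dif_sum_0:
  assumes "Re s > 1"
  shows "alt_dif_sum 0 s = (1 - 2 powr (1 - s)) * (\<Sum>n. of_real (real (Suc n)) powr (- s))"
proof -
  define f where "f = (\<lambda>n. complex_of_real (real (Suc n)) powr (- s))"
  \<comment> \<open>Indices start at zero, so the odd \<open>n\<close> carry the even integers
    \<open>Suc n\<close>.\<close>
  define g where "g = (\<lambda>n. if odd n then f n else 0)"
  have f: "f sums suminf f"
    using summable_dirichlet[OF assms] unfolding f_def by (rule summable_sums)
  have "f (2 * n + 1) = 2 powr (- s) * f n" for n
  proof -
    have "f (2 * n + 1) = of_real (2 * real (Suc n)) powr (- s)"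
      unfolding f_def by (rule arg_cong[where f = "\<lambda>x. of_real x powr (- s)"]) simp
    also have "\<dots> = exp (- s * of_real (ln 2 + ln (real (Suc n))))"
      by (subst of_real_powr_eq_exp, simp, subst ln_mult) auto
    also have "\<dots> = of_real 2 powr (- s) * of_real (real (Suc n)) powr (- s)"
      by (subst (1 2) of_real_powr_eq_exp) (auto simp: algebra_simps exp_add[symmetric] exp_diff)
    finally show ?thesis by (simp add: f_def)
  qed
  hence "(\<lambda>n. g (2 * n + 1)) sums (2 powr (- s) * suminf f)"
    using sums_mult[OF f, of "2 powr (- s)"] by (simp add: g_def)
  hence "g sums (2 powr (- s) * suminf f)"
  proof (subst (asm) sums_mono_reindex)
    show "strict_mono (\<lambda>n::nat. 2 * n + 1)" by (auto simp: strict_mono_def)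
    show "g n = 0" if "n \<notin> range (\<lambda>n. 2 * n + 1)" for n
      using that by (auto simp: g_def elim!: oddE)
  qed
  from sums_diff[OF f sums_mult[OF this, of 2]]
  have "(\<lambda>n. (-1) ^ n * dif 0 s (real (Suc n))) sums (suminf f - 2 * (2 powr (- s) * suminf f))"
    by (rule sums_cong[THEN iffD1, rotated]) (auto simp: g_def f_def)
  moreover have "2 powr (1 - s) = 2 * 2 powr (- s)"
    using powr_add[of "2::complex" 1 "- s"] by simp
  ultimately show ?thesis
    unfolding alt_dif_sum_def f_def by (simp add: sums_iff algebra_simps)
qed

section \<open>First-order Euler-Maclaurin summation and identification of zeta\<close>

text \<open>For \<open>s \<noteq> 1\<close> and \<open>a = Suc n\<close>, this is
  \<open>a powr (- s)\<close> minus the integral of \<open>x powr (- s)\<close> over the interval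
  from \<open>a\<close> to \<open>a + 1\<close>.\<close>

definition zeta_term :: "nat \<Rightarrow> complex \<Rightarrow> complex" where
  "zeta_term n s = of_real (real (Suc n)) powr (- s) -
     (of_real (real (Suc n)) powr (1 - s) - of_real (real (Suc (Suc n))) powr (1 - s)) / (s - 1)"

text \<open>The term is the integral of \<open>a powr (- s) - y powr (- s)\<close> over a unit
  interval starting at \<open>a\<close>. One mean value inequality bounds the integrand and thereby
  gains a factor \<open>1 / a\<close>; a second one replaces the integration.\<close>

lemma norm_zeta_term_le:
  assumes "s \<noteq> 1" "\<sigma> \<le> Re s" "\<sigma> > 0" "norm s \<le> R"
  shows "norm (zeta_term n s) \<le> R * real (Suc n) powr (- \<sigma> - 1)"
proof -
  define x where "x = real (Suc n)"
  have x: "x \<ge> 1" by (simp add: x_def)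
  have R: "R \<ge> 0" using assms(4) norm_ge_zero order_trans by blast
  have diff_le: "norm (of_real y powr (- s) - of_real x powr (- s)) \<le> R * x powr (- \<sigma> - 1)"
    if y: "x < y" "y \<le> x + 1" for y
  proof -
    have "\<exists>u\<in>{x<..<y}. norm (of_real y powr (- s) - of_real x powr (- s))
        \<le> norm ((\<lambda>h. h *\<^sub>R (- s * of_real u powr (- s - 1))) (y - x))"
    proof (rule mvt_general)
      show "continuous_on {x..y} (\<lambda>y. complex_of_real y powr (- s))"
        using x by (intro continuous_at_imp_continuous_on ballI
            has_vector_derivative_continuous[OF has_vector_derivative_of_real_powr]) auto
    next
      fix u assume "x < u" "u < y"
      thus "((\<lambda>y. complex_of_real y powr (- s)) has_derivative
          (\<lambda>h. h *\<^sub>R (- s * of_real u powr (- s - 1)))) (at u)"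
        using x has_vector_derivative_of_real_powr[of u "- s"] by (simp add: has_vector_derivative_def)
    qed (use y in simp)
    then obtain u where u: "x < u" "u < y" "norm (of_real y powr (- s) - of_real x powr (- s))
        \<le> (y - x) * (norm s * u powr (- Re s - 1))"
      using x y by (auto simp: norm_mult norm_of_real_powr)
    have "u powr (- Re s - 1) \<le> u powr (- \<sigma> - 1)"
      using u x assms by (intro powr_mono) auto
    also have "\<dots> \<le> x powr (- \<sigma> - 1)"
      using u x assms by (intro powr_mono2') auto
    finally have "(y - x) * (norm s * u powr (- Re s - 1)) \<le> 1 * (R * x powr (- \<sigma> - 1))"
      using y assms R by (intro mult_mono) auto
    thus ?thesis using u(3) by simp
  qed
  \<comment> \<open>A primitive in \<open>y\<close> of the difference bounded above; its increment
    over the unit interval is the term.\<close>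
  define \<phi> where "\<phi> = (\<lambda>y. y *\<^sub>R of_real x powr (- s) - inverse (1 - s) * of_real y powr (1 - s))"
  have der: "(\<phi> has_vector_derivative of_real x powr (- s) - of_real y powr (- s)) (at y)" if "y \<ge> x" for y
  proof -
    have "((\<lambda>y. inverse (1 - s) * of_real y powr (1 - s)) has_vector_derivative
        inverse (1 - s) * ((1 - s) * of_real y powr (1 - s - 1))) (at y)"
      using x that by (intro has_vector_derivative_mult_right has_vector_derivative_of_real_powr) auto
    moreover have "inverse (1 - s) * ((1 - s) * of_real y powr (1 - s - 1)) = of_real y powr (- s)"
      using assms(1) by simp
    ultimately have "((\<lambda>y. inverse (1 - s) * of_real y powr (1 - s)) has_vector_derivative of_real y powr (- s)) (at y)"
      by (simp only:)
    moreover have "((\<lambda>y. y *\<^sub>R complex_of_real x powr (- s)) has_vector_derivative of_real x powr (- s)) (at y)"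
      by (auto intro!: derivative_eq_intros)
    ultimately show ?thesis unfolding \<phi>_def
      by (rule has_vector_derivative_diff[rotated])
  qed
  have "\<exists>u\<in>{x<..<x+1}. norm (\<phi> (x + 1) - \<phi> x)
      \<le> norm ((\<lambda>h. h *\<^sub>R (of_real x powr (- s) - of_real u powr (- s))) (x + 1 - x))"
  proof (rule mvt_general)
    show "continuous_on {x..x + 1} \<phi>"
      by (intro continuous_at_imp_continuous_on ballI has_vector_derivative_continuous[OF der]) auto
    fix u assume "x < u" "u < x + 1"
    thus "(\<phi> has_derivative (\<lambda>h. h *\<^sub>R (of_real x powr (- s) - of_real u powr (- s)))) (at u)"
      using der[of u] by (simp add: has_vector_derivative_def)
  qed simp
  then obtain u where u: "x < u" "u < x + 1" "norm (\<phi> (x + 1) - \<phi> x)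
      \<le> norm (of_real x powr (- s) - complex_of_real u powr (- s))"
    by auto
  have "zeta_term n s = \<phi> (x + 1) - \<phi> x"
  proof -
    have "inverse (1 - s) = - inverse (s - 1)"
      by (metis inverse_minus_eq minus_diff_eq)
    moreover have "x + 1 = real (Suc (Suc n))" by (simp add: x_def)
    ultimately show ?thesis
      unfolding zeta_term_def \<phi>_def x_def[symmetric] divide_inverse
      by (simp add: algebra_simps scaleR_conv_of_real)
  qed
  thus ?thesis using u(3) diff_le[of u] u x
    by (simp add: norm_minus_commute x_def)
qed

lemma summable_zeta_term:
  assumes "s \<noteq> 1" "Re s > 0"
  shows "summable (\<lambda>n. zeta_term n s)"
proof (rule summable_comparison_test')
  show "summable (\<lambda>n. norm s * real (Suc n) powr (- Re s - 1))"
    using assms by (intro summable_mult summable_Suc_powr) auto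
  show "norm (zeta_term n s) \<le> norm s * real (Suc n) powr (- Re s - 1)" for n
    using assms by (intro norm_zeta_term_le) auto
qed

lemma open_punctured_half_plane: "open ({s. Re s > 0} - {1})"
  by (intro open_Diff open_Collect_less continuous_intros closed_singleton)

lemma suminf_zeta_term_holomorphic: "(\<lambda>s. \<Sum>n. zeta_term n s) holomorphic_on ({s. Re s > 0} - {1})"
proof (rule holomorphic_suminf[OF open_punctured_half_plane])
  show "zeta_term n holomorphic_on ({s. Re s > 0} - {1})" for n
    unfolding zeta_term_def[abs_def] by (intro holomorphic_intros) auto
next
  fix x assume x: "x \<in> {s. Re s > 0} - {1}"
  define d where "d = Re x / 2"
  define M where "M = (\<lambda>n. (norm x + d) * real (Suc n) powr (- (Re x - d) - 1))"
  have "d > 0" using x by (simp add: d_def)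
  moreover have "summable M" unfolding M_def
    using x by (intro summable_mult summable_Suc_powr) (auto simp: d_def)
  moreover have "norm (zeta_term n y) \<le> M n" if "y \<in> ball x d \<inter> ({s. Re s > 0} - {1})" for n y
  proof -
    have "norm (y - x) < d" using that by (simp add: dist_norm norm_minus_commute)
    hence "norm y \<le> norm x + d" "Re x - d \<le> Re y"
      using norm_triangle_sub[of y x] abs_Re_le_cmod[of "y - x"] by auto
    thus ?thesis unfolding M_def using x that by (intro norm_zeta_term_le) (auto simp: d_def)
  qed
  ultimately show "\<exists>d>0. \<exists>M. summable M \<and>
      (\<forall>n. \<forall>y\<in>ball x d \<inter> ({s. Re s > 0} - {1}). norm (zeta_term n y) \<le> M n)"
    by blast
qed

text \<open>To the right of 1 the integral parts telescope to \<open>1 / (s - 1)\<close>, the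
  integral of \<open>x powr (- s)\<close> from 1 to infinity.\<close>

lemma suminf_zeta_term:
  assumes "Re s > 1"
  shows "1 / (s - 1) + (\<Sum>n. zeta_term n s) = (\<Sum>n. of_real (real (Suc n)) powr (- s))"
proof -
  let ?f = "\<lambda>n. complex_of_real (real (Suc n)) powr (1 - s)"
  have "?f \<longlonglongrightarrow> 0"
    using assms by (intro tendsto_neg_powr_complex_of_real
        filterlim_compose[OF filterlim_real_sequentially filterlim_Suc]) auto
  hence "(\<lambda>n. (?f n - ?f (Suc n)) / (s - 1)) sums (1 / (s - 1))"
    using sums_divide[OF telescope_sums'[OF \<open>?f \<longlonglongrightarrow> 0\<close>], of "s - 1"] by simp
  from sums_diff[OF summable_sums[OF summable_dirichlet[OF assms]] this]
  show ?thesis by (simp add: sums_iff zeta_term_def)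
qed

text \<open>The quotient \<open>eta s / (1 - 2 powr (1 - s))\<close> has removable singularities on the line
  \<open>Re s = 1\<close>, where it is replaced by the Euler-Maclaurin formula of first order.\<close>

definition zeta_cont :: "complex \<Rightarrow> complex" where
  "zeta_cont s = (if s = 1 then 0 else if Re s > 0 then 1 / (s - 1) + (\<Sum>n. zeta_term n s)
     else eta s / (1 - 2 powr (1 - s)))"

text \<open>For \<open>Re s > 1\<close> both sides are the alternating Dirichlet series. The
  punctured half-plane is open and connected, so the identity theorem extends the equation to all of
  it, including the zeros of the factor on \<open>Re s = 1\<close> other than 1.\<close>

lemma eta_eq_zeta_cont:
  assumes "Re s > 0" "s \<noteq> 1"
  shows "eta s = (1 - 2 powr (1 - s)) * zeta_cont s"
proof -
  have "eta s = (1 - 2 powr (1 - s)) * (1 / (s - 1) + (\<Sum>n. zeta_term n s))"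
  proof (rule analytic_continuation_open[where s = "{s. Re s > 1}" and s' = "{s. Re s > 0} - {1}"
        and g = "\<lambda>s. (1 - 2 powr (1 - s)) * (1 / (s - 1) + (\<Sum>n. zeta_term n s))"])
    show "open {s. Re s > 1}" by (intro open_Collect_less continuous_intros)
    have "2 \<in> {s::complex. Re s > 1}" by simp
    thus "{s::complex. Re s > 1} \<noteq> {}" by blast
    show "connected ({s. Re s > 0} - {1})"
      by (intro connected_open_delete convex_connected convex_halfspace_Re_gt
          open_Collect_less continuous_intros) auto
    show "(\<lambda>s. (1 - 2 powr (1 - s)) * (1 / (s - 1) + (\<Sum>n. zeta_term n s)))
        holomorphic_on {s. Re s > 0} - {1}"
      by (intro holomorphic_intros suminf_zeta_term_holomorphic) auto
    show "eta z = (1 - 2 powr (1 - z)) * (1 / (z - 1) + (\<Sum>n. zeta_term n z))"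
      if "z \<in> {s. Re s > 1}" for z
      using that by (subst suminf_zeta_term) (auto simp: eta_eq[of z 0] eta_at_def alt_dif_sum_0)
  qed (use assms open_punctured_half_plane eta_holomorphic in auto)
  thus ?thesis using assms by (simp add: zeta_cont_def)
qed

lemma two_powr_neq_1:
  assumes "Re s < 1"
  shows "2 powr (1 - s) \<noteq> 1"
proof
  assume "2 powr (1 - s) = 1"
  hence "norm (complex_of_real 2 powr (1 - s)) = 1" by simp
  thus False using assms by (subst (asm) norm_of_real_powr) auto
qed

lemma zeta_cont_eq_eta:
  assumes "Re s < 1"
  shows "zeta_cont s = eta s / (1 - 2 powr (1 - s))"
proof (cases "Re s > 0")
  case True
  hence "s \<noteq> 1" using assms by auto
  thus ?thesis using eta_eq_zeta_cont[OF True] two_powr_neq_1[OF assms] by simp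
next
  case False
  thus ?thesis by (auto simp: zeta_cont_def)
qed

lemma zeta_cont_holomorphic: "zeta_cont holomorphic_on (- {1})"
proof -
  have "zeta_cont holomorphic_on ({s. Re s > 0} - {1}) \<union> {s. Re s < 1}"
  proof (rule holomorphic_on_Un)
    have "(\<lambda>s. 1 / (s - 1) + (\<Sum>n. zeta_term n s)) holomorphic_on ({s. Re s > 0} - {1})"
      by (intro holomorphic_intros suminf_zeta_term_holomorphic) auto
    thus "zeta_cont holomorphic_on ({s. Re s > 0} - {1})"
      by (rule holomorphic_transform) (auto simp: zeta_cont_def)
    have "(\<lambda>s. eta s / (1 - 2 powr (1 - s))) holomorphic_on {s. Re s < 1}"
      by (intro holomorphic_intros eta_holomorphic) (use two_powr_neq_1 in auto)
    thus "zeta_cont holomorphic_on {s. Re s < 1}"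
      by (rule holomorphic_transform) (auto simp: zeta_cont_eq_eta)
    show "open {s. Re s < 1}" by (intro open_Collect_less continuous_intros)
  qed (rule open_punctured_half_plane)
  thus ?thesis by (rule holomorphic_on_subset) auto
qed

text \<open>Uniqueness is the identity theorem on the connected plane punctured at 1; the value at
  the puncture is settled separately by the normalisation \<open>f 1 = 0\<close>.\<close>

lemma riemann_zeta_eq: "riemann_zeta = zeta_cont"
  unfolding riemann_zeta_def
proof (rule the_equality)
  have eq: "zeta_cont s = (\<Sum>n. 1 / of_nat (Suc n) powr s)" if "Re s > 1" for s
  proof -
    have "s \<noteq> 1" using that by auto
    thus ?thesis using that suminf_zeta_term[of s] by (simp add: zeta_cont_def powr_minus_divide)
  qed
  thus "zeta_cont holomorphic_on - {1} \<and>
      (\<forall>s. Re s > 1 \<longrightarrow> zeta_cont s = (\<Sum>n. 1 / of_nat (Suc n) powr s)) \<and> zeta_cont 1 = 0"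
    using zeta_cont_holomorphic by (auto simp: zeta_cont_def)
  fix f assume f: "f holomorphic_on - {1} \<and>
      (\<forall>s. Re s > 1 \<longrightarrow> f s = (\<Sum>n. 1 / of_nat (Suc n) powr s)) \<and> f 1 = 0"
  show "f = zeta_cont"
  proof
    fix s
    show "f s = zeta_cont s"
    proof (cases "s = 1")
      case True
      thus ?thesis using f by (simp add: zeta_cont_def)
    next
      case False
      show ?thesis
      proof (rule analytic_continuation_open[where f = f and g = zeta_cont and s = "{s. Re s > 1}" and s' = "- {1}"])
        show "open {s. Re s > 1}" by (intro open_Collect_less continuous_intros)
        have "2 \<in> {s::complex. Re s > 1}" by simp
        thus "{s::complex. Re s > 1} \<noteq> {}" by blast
        show "connected (- {1 :: complex})"
          by (simp add: connected_punctured_universe)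
      qed (use f eq zeta_cont_holomorphic False in auto)
    qed
  qed
qed

section \<open>Nonvanishing of zeta on the real interval (0, 1)\<close>

text \<open>Since \<open>y powr (- x)\<close> decreases in \<open>y\<close>, its integral over a
  unit interval is at least its value at the right end. The resulting bound telescopes.\<close>

lemma Re_zeta_term_le:
  assumes "0 < x" "x < 1"
  shows "Re (zeta_term n (of_real x)) \<le> real (Suc n) powr (- x) - real (Suc (Suc n)) powr (- x)"
proof -
  define a where "a = real (Suc n)"
  have a: "a > 0" "real (Suc (Suc n)) = a + 1" by (simp_all add: a_def)
  have "\<exists>z>a. z < a + 1 \<and> (a + 1) powr (1 - x) - a powr (1 - x) = (a + 1 - a) * ((1 - x) * z powr (- x))"
    using a by (intro MVT2) (auto intro!: derivative_eq_intros)
  then obtain z where z: "a < z" "z < a + 1" "(a + 1) powr (1 - x) - a powr (1 - x) = (1 - x) * z powr (- x)"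
    by auto
  have "(a + 1) powr (- x) \<le> z powr (- x)"
    using z a assms by (intro powr_mono2') auto
  also have "\<dots> = ((a + 1) powr (1 - x) - a powr (1 - x)) / (1 - x)"
    using z assms by simp
  also have "\<dots> = (a powr (1 - x) - (a + 1) powr (1 - x)) / (x - 1)"
    using assms by (simp add: divide_simps) (simp add: algebra_simps)
  finally have le: "(a + 1) powr (- x) \<le> (a powr (1 - x) - (a + 1) powr (1 - x)) / (x - 1)" .
  have "zeta_term n (of_real x) = of_real (a powr (- x) - (a powr (1 - x) - (a + 1) powr (1 - x)) / (x - 1))"
    unfolding zeta_term_def a(2) a_def[symmetric]
    using a(1) powr_of_real[of a "- x"] powr_of_real[of a "1 - x"] powr_of_real[of "a + 1" "1 - x"] by simp
  thus ?thesis using le unfolding a(2) a_def[symmetric] by simp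
qed

text \<open>The telescoping bound keeps the series at most 1 in real part, while
  \<open>1 / (x - 1) < -1\<close>; hence the real part of the sum is negative.\<close>

lemma zeta_cont_real_neq_0:
  assumes "0 < x" "x < 1"
  shows "zeta_cont (of_real x) \<noteq> 0"
proof -
  have "(\<lambda>n. real (Suc n) powr (- x)) \<longlonglongrightarrow> 0"
    using assms by (intro tendsto_neg_powr filterlim_compose[OF filterlim_real_sequentially filterlim_Suc]) auto
  from telescope_sums'[OF this]
  have sums: "(\<lambda>n. real (Suc n) powr (- x) - real (Suc (Suc n)) powr (- x)) sums 1" by simp
  have "(\<lambda>n. zeta_term n (of_real x)) sums (\<Sum>n. zeta_term n (of_real x))"
    using assms by (intro summable_sums summable_zeta_term) auto
  from sums_Re[OF this] have "Re (\<Sum>n. zeta_term n (of_real x)) \<le> 1"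
    by (rule sums_le[OF Re_zeta_term_le[OF assms] _ sums])
  moreover have "1 / (x - 1) < -1"
    using assms by (simp add: divide_simps)
  moreover have "Re (1 / (complex_of_real x - 1)) = 1 / (x - 1)"
  proof -
    have "1 / (complex_of_real x - 1) = complex_of_real (1 / (x - 1))" by simp
    thus ?thesis by (simp only: Re_complex_of_real)
  qed
  moreover have "complex_of_real x \<noteq> 1"
    using assms by auto
  ultimately have "Re (zeta_cont (of_real x)) < 0"
    using assms by (simp add: zeta_cont_def)
  thus ?thesis by auto
qed

section \<open>Growth of eta to the left and a lower bound on the line Re s = 2\<close>

text \<open>For the head terms of \<open>eta_at\<close>, where \<open>Re s + j\<close> may be
  negative and \<open>norm_dif_le\<close> does not apply. The triangle inequality suffices because
  only the fixed point \<open>x = 1\<close> matters there; the power 5 comes from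
  \<open>Re s \<ge> -5\<close>.\<close>

lemma norm_dif_le_left:
  assumes "x \<ge> 1" "Re s \<ge> -5"
  shows "norm (dif j s x) \<le> 2 ^ j * (x + j) ^ 5"
  using assms(1)
proof (induction j arbitrary: x)
  case 0
  have "x powr (- Re s) \<le> x powr (real 5)"
    using 0 assms by (intro powr_mono) auto
  also have "\<dots> = x ^ 5" using 0 by (subst powr_realpow) auto
  finally show ?case using 0 by (simp add: norm_of_real_powr)
next
  case (Suc j)
  have "norm (dif (Suc j) s x) \<le> norm (dif j s x) + norm (dif j s (x + 1))"
    by (simp add: norm_triangle_ineq4)
  also have "\<dots> \<le> 2 ^ j * (x + j) ^ 5 + 2 ^ j * (x + 1 + j) ^ 5"
    using Suc.prems Suc.IH[of x] Suc.IH[of "x + 1"] by (intro add_mono) auto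
  also have "\<dots> \<le> 2 ^ j * (x + 1 + j) ^ 5 + 2 ^ j * (x + 1 + j) ^ 5"
    using Suc.prems by (intro add_mono mult_left_mono power_mono) auto
  finally show ?case by (simp add: algebra_simps)
qed

text \<open>Order 7 turns \<open>Re s \<ge> -5\<close> into the summable exponent \<open>-2\<close>.
  The limit \<open>-5\<close> leaves room for the circles of the zero count, which reach real part
  \<open>-4.3\<close>.\<close>

lemma eta_polynomial_bound:
  obtains C where "C > 0" "\<And>s. Re s \<ge> -5 \<Longrightarrow> norm (eta s) \<le> C * (norm s + 7) ^ 7"
proof
  define Q where "Q = (\<Sum>n. real (Suc n) powr (-2))"
  have Q: "summable (\<lambda>n. real (Suc n) powr (-2))" by (rule summable_Suc_powr) simp
  have Q0: "Q \<ge> 0" unfolding Q_def by (intro suminf_nonneg Q) auto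
  define D where "D = (\<Sum>j<7::nat. 2 ^ j * (1 + real j) ^ 5 / 2 ^ Suc j :: real)"
  have D: "D \<ge> 0" unfolding D_def by (intro sum_nonneg) auto
  show "D + Q + 1 > 0" using Q0 D by simp
  fix s assume s: "Re s \<ge> -5"
  have "norm (alt_dif_sum 7 s) \<le> (\<Sum>n. (norm s + 7) ^ 7 * real (Suc n) powr (-2))"
    unfolding alt_dif_sum_def
  proof (rule norm_suminf_le)
    show "norm ((-1) ^ n * dif 7 s (real (Suc n))) \<le> (norm s + 7) ^ 7 * real (Suc n) powr (-2)" for n
      using norm_dif_le_of_bounds[of s "norm s" "-5" 7 "real (Suc n)"] s
      by (simp add: norm_mult norm_power)
  qed (intro summable_mult Q)
  also have "\<dots> = (norm s + 7) ^ 7 * Q"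
    unfolding Q_def by (rule suminf_mult[OF Q])
  finally have E: "norm (alt_dif_sum 7 s / 2 ^ 7) \<le> (norm s + 7) ^ 7 * Q"
    using norm_ge_zero[of "alt_dif_sum 7 s"] by (simp add: norm_divide del: norm_ge_zero)
  have "norm (\<Sum>j<7. dif j s 1 / 2 ^ Suc j) \<le> D"
    unfolding D_def
  proof (rule sum_norm_le)
    fix j :: nat
    show "norm (dif j s 1 / 2 ^ Suc j) \<le> 2 ^ j * (1 + real j) ^ 5 / 2 ^ Suc j"
      using norm_dif_le_left[of 1 s j] s
      unfolding norm_divide norm_mult norm_power by (intro divide_mono) auto
  qed
  moreover have "eta s = (\<Sum>j<7. dif j s 1 / 2 ^ Suc j) + alt_dif_sum 7 s / 2 ^ 7"
    using s eta_eq[of s 7] unfolding eta_at_def by simp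
  hence "norm (eta s) \<le> norm (\<Sum>j<7. dif j s 1 / 2 ^ Suc j) + norm (alt_dif_sum 7 s / 2 ^ 7)"
    by (simp only: norm_triangle_ineq)
  moreover have "D * 1 \<le> D * (norm s + 7) ^ 7"
    using D by (intro mult_left_mono one_le_power) auto
  moreover have "(norm s + 7) ^ 7 \<ge> 0" by simp
  ultimately have "norm (eta s) \<le> D * (norm s + 7) ^ 7 + (norm s + 7) ^ 7 * Q + (norm s + 7) ^ 7"
    using E by linarith
  thus "norm (eta s) \<le> (D + Q + 1) * (norm s + 7) ^ 7"
    by (simp add: algebra_simps)
qed

text \<open>The terms after the first have total norm at most
  \<open>pi\<^sup>2 / 6 - 1 \<le> 3 / 4\<close>. The bound is uniform in the height, as the centres
  of the zero count require.\<close>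

lemma norm_eta_ge:
  assumes "Re s = 2"
  shows "norm (eta s) \<ge> 1 / 4"
proof -
  let ?f = "\<lambda>n. (-1) ^ n * dif 0 s (real (Suc n))"
  have S: "summable ?f" using assms by (intro summable_alt_dif) auto
  have sq: "(\<lambda>n. 1 / (real n + 1)\<^sup>2) sums (pi\<^sup>2 / 6)"
    using inverse_squares_sums by (simp add: add.commute)
  have "norm (\<Sum>n. ?f (Suc n)) \<le> (\<Sum>n. 1 / (real (Suc n) + 1)\<^sup>2)"
  proof (rule norm_suminf_le)
    show "norm (?f (Suc n)) \<le> 1 / (real (Suc n) + 1)\<^sup>2" for n
    proof -
      have "norm (?f (Suc n)) = real (Suc (Suc n)) powr (- real 2)"
        using assms norm_of_real_powr[of "real (Suc (Suc n))" "- s"] by (simp add: norm_mult norm_power)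
      thus ?thesis by (simp add: powr_minus_divide powr_realpow add.commute[of _ 1] del: of_nat_numeral)
    qed
    show "summable (\<lambda>n. 1 / (real (Suc n) + 1)\<^sup>2)"
      using sums_summable[OF sq] summable_Suc_iff[of "\<lambda>n. 1 / (real n + 1)\<^sup>2"] by simp
  qed
  also have "\<dots> = pi\<^sup>2 / 6 - 1"
    using suminf_split_head[OF sums_summable[OF sq]] sums_unique[OF sq] by simp
  finally have tail: "norm (\<Sum>n. ?f (Suc n)) \<le> pi\<^sup>2 / 6 - 1" .
  have "pi \<le> 3.2" using pi_approx by simp
  hence "pi\<^sup>2 \<le> 3.2\<^sup>2" by (intro power_mono) auto
  hence pi: "pi\<^sup>2 / 6 - 1 \<le> 3 / 4" by (simp add: power2_eq_square)
  have "eta s = 1 + (\<Sum>n. ?f (Suc n))"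
    using suminf_split_head[OF S] assms by (simp add: eta_eq[of s 0] eta_at_def alt_dif_sum_def)
  hence "norm (eta s) \<ge> 1 - norm (\<Sum>n. ?f (Suc n))"
    using norm_triangle_ineq4[of "eta s" "\<Sum>n. ?f (Suc n)"] by simp
  thus ?thesis using tail pi by linarith
qed

section \<open>Counting zeros\<close>

lemma entire_divide_out_zeros:
  fixes f :: "complex \<Rightarrow> complex"
  assumes f: "f holomorphic_on UNIV" "f c \<noteq> 0" and "finite Z"
  shows "\<exists>g. g holomorphic_on UNIV \<and> (\<forall>s. f s = g s * (\<Prod>\<rho>\<in>Z. (s - \<rho>) ^ nat (zorder f \<rho>)))"
  using \<open>finite Z\<close>
proof (induction Z)
  case empty
  thus ?case using f by (intro exI[of _ f]) auto
next
  case (insert \<rho> Z)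
  define P where "P = (\<lambda>s. \<Prod>\<rho>\<in>Z. (s - \<rho>) ^ nat (zorder f \<rho>))"
  define n where "n = nat (zorder f \<rho>)"
  define h where "h = zor_poly f \<rho>"
  obtain g where g: "g holomorphic_on UNIV" "\<And>s. f s = g s * P s"
    using insert.IH unfolding P_def by blast
  have P\<rho>: "P \<rho> \<noteq> 0" unfolding P_def using insert.hyps by (auto simp: prod_zero_iff)
  have P_hol: "P holomorphic_on A" for A unfolding P_def by (intro holomorphic_intros)
  obtain r where r: "r > 0" "h holomorphic_on cball \<rho> r" "\<And>w. w \<in> cball \<rho> r \<Longrightarrow> f w = h w * (w - \<rho>) ^ n"
    using zorder_exist_zero[OF f(1) open_UNIV connected_UNIV UNIV_I, of \<rho>] f(2) unfolding h_def n_def by blast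
  define U where "U = ball \<rho> r \<inter> P -` (- {0})"
  have "open U" unfolding U_def
    by (intro open_Int open_ball open_vimage continuous_on_subset[OF holomorphic_on_imp_continuous_on[OF P_hol[of UNIV]]]) auto
  have "\<rho> \<in> U" using r P\<rho> by (simp add: U_def)
  \<comment> \<open>Near \<open>\<rho>\<close> both \<open>f = g * P\<close> and
    \<open>f = h * (w - \<rho>) ^ n\<close> hold with \<open>P\<close> nonzero, so
    \<open>h / P\<close> fills the puncture of \<open>g / (w - \<rho>) ^ n\<close>
    holomorphically.\<close>
  define g' where "g' = (\<lambda>w. if w = \<rho> then h \<rho> / P \<rho> else g w / (w - \<rho>) ^ n)"
  have "g' holomorphic_on U \<union> - {\<rho>}"
  proof (rule holomorphic_on_Un)
    have "(\<lambda>w. h w / P w) holomorphic_on U"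
      by (intro holomorphic_on_divide P_hol holomorphic_on_subset[OF r(2)]) (auto simp: U_def)
    thus "g' holomorphic_on U"
    proof (rule holomorphic_transform)
      fix w assume w: "w \<in> U"
      have "g w * P w = h w * (w - \<rho>) ^ n" "P w \<noteq> 0"
        using w r(3)[of w] g(2)[of w] by (auto simp: U_def)
      thus "h w / P w = g' w"
        by (auto simp: g'_def field_simps)
    qed
    have "(\<lambda>w. g w / (w - \<rho>) ^ n) holomorphic_on - {\<rho>}"
      by (intro holomorphic_intros holomorphic_on_subset[OF g(1)]) auto
    thus "g' holomorphic_on - {\<rho>}"
      by (rule holomorphic_transform) (auto simp: g'_def)
  qed (use \<open>open U\<close> in auto)
  moreover have "U \<union> - {\<rho>} = UNIV" using \<open>\<rho> \<in> U\<close> by auto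
  ultimately have "g' holomorphic_on UNIV" by simp
  moreover have "f s = g' s * ((s - \<rho>) ^ n * P s)" for s
  proof (cases "s = \<rho>")
    case True
    thus ?thesis using r(3)[of \<rho>] r(1) P\<rho> by (simp add: g'_def)
  next
    case False
    thus ?thesis using g(2)[of s] by (simp add: g'_def)
  qed
  ultimately show ?case
    unfolding P_def n_def prod.insert[OF insert.hyps] by blast
qed

text \<open>Dividing out the zeros costs at least a factor \<open>2 r\<close> per zero on the circle of radius
  \<open>3 r\<close> and gains at most \<open>r\<close> at the centre.\<close>

lemma zero_count_bound:
  fixes f :: "complex \<Rightarrow> complex"
  assumes f: "f holomorphic_on UNIV" "f c \<noteq> 0" and Z: "finite Z" "Z \<subseteq> cball c r" and "r > 0"
    and M: "\<And>s. dist c s = 3 * r \<Longrightarrow> norm (f s) \<le> M"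
  shows "norm (f c) * 2 ^ (\<Sum>\<rho>\<in>Z. nat (zorder f \<rho>)) \<le> M"
proof -
  let ?n = "\<Sum>\<rho>\<in>Z. nat (zorder f \<rho>)"
  obtain g where g: "g holomorphic_on UNIV" "\<And>s. f s = g s * (\<Prod>\<rho>\<in>Z. (s - \<rho>) ^ nat (zorder f \<rho>))"
    using entire_divide_out_zeros[OF f Z(1)] by blast
  have "norm (g c) \<le> M / (2 * r) ^ ?n"
  proof (rule maximum_modulus_frontier[where f = g and S = "cball c (3 * r)"])
    show "g holomorphic_on interior (cball c (3 * r))"
      by (rule holomorphic_on_subset[OF g(1)]) auto
    show "continuous_on (closure (cball c (3 * r))) g"
      by (rule continuous_on_subset[OF holomorphic_on_imp_continuous_on[OF g(1)]]) auto
  next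
    fix s assume "s \<in> frontier (cball c (3 * r))"
    hence s: "dist c s = 3 * r" using \<open>r > 0\<close> by (auto simp: frontier_cball)
    have "(2 * r) ^ ?n = (\<Prod>\<rho>\<in>Z. (2 * r) ^ nat (zorder f \<rho>))" by (rule power_sum)
    also have "\<dots> \<le> (\<Prod>\<rho>\<in>Z. norm (s - \<rho>) ^ nat (zorder f \<rho>))"
    proof (intro prod_mono conjI power_mono)
      fix \<rho> assume "\<rho> \<in> Z"
      hence "dist c \<rho> \<le> r" using Z by auto
      thus "2 * r \<le> norm (s - \<rho>)"
        using dist_triangle[of c s \<rho>] s by (simp add: dist_norm norm_minus_commute)
    qed (use \<open>r > 0\<close> in auto)
    also have "\<dots> = norm (\<Prod>\<rho>\<in>Z. (s - \<rho>) ^ nat (zorder f \<rho>))"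
      by (simp add: prod_norm[symmetric] norm_power)
    finally have "norm (g s) * (2 * r) ^ ?n \<le> norm (f s)"
      unfolding g(2)[of s] norm_mult by (intro mult_left_mono) auto
    also have "\<dots> \<le> M" by (rule M[OF s])
    finally show "norm (g s) \<le> M / (2 * r) ^ ?n"
      using \<open>r > 0\<close> by (simp add: pos_le_divide_eq)
  qed (use \<open>r > 0\<close> in auto)
  hence g_le: "norm (g c) * (2 * r) ^ ?n \<le> M"
    using \<open>r > 0\<close> by (simp add: pos_le_divide_eq)
  have "norm (\<Prod>\<rho>\<in>Z. (c - \<rho>) ^ nat (zorder f \<rho>)) = (\<Prod>\<rho>\<in>Z. norm (c - \<rho>) ^ nat (zorder f \<rho>))"
    by (simp add: prod_norm[symmetric] norm_power)
  also have "\<dots> \<le> (\<Prod>\<rho>\<in>Z. r ^ nat (zorder f \<rho>))"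
    using Z by (intro prod_mono conjI power_mono) (auto simp: dist_norm)
  also have "\<dots> = r ^ ?n" by (rule power_sum[symmetric])
  finally have "norm (f c) \<le> norm (g c) * r ^ ?n"
    unfolding g(2)[of c] norm_mult by (intro mult_left_mono) auto
  hence "norm (f c) * 2 ^ ?n \<le> norm (g c) * r ^ ?n * 2 ^ ?n"
    by (intro mult_right_mono) auto
  also have "\<dots> = norm (g c) * (2 * r) ^ ?n" by (simp add: power_mult_distrib)
  finally show ?thesis using g_le by linarith
qed

section \<open>Multiplicities and vertical distribution of the nontrivial zeros\<close>

lemma eta_2_neq_0: "eta 2 \<noteq> 0"
  using norm_eta_ge[of 2] by auto

text \<open>To the left of \<open>Re s = 1\<close>, zeta is \<open>eta\<close> divided by a
  zero-free holomorphic function, which leaves orders unchanged. The order is finite because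
  \<open>eta\<close> does not vanish at 2.\<close>

lemma zorder_riemann_zeta:
  assumes "\<rho> \<in> nontrivial_zeros"
  shows "zorder riemann_zeta \<rho> = zorder eta \<rho>" "zorder riemann_zeta \<rho> > 0"
proof -
  have \<rho>: "zeta_cont \<rho> = 0" "Re \<rho> < 1"
    using assms by (auto simp: nontrivial_zeros_def riemann_zeta_eq)
  hence "eta \<rho> = 0" using zeta_cont_eq_eta[of \<rho>] two_powr_neq_1[of \<rho>] by auto
  then obtain r where r: "r > 0" "zor_poly eta \<rho> holomorphic_on cball \<rho> r" "zorder eta \<rho> > 0"
     "\<And>w. w \<in> cball \<rho> r \<Longrightarrow> eta w = zor_poly eta \<rho> w * (w - \<rho>) ^ nat (zorder eta \<rho>) \<and> zor_poly eta \<rho> w \<noteq> 0"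
    using zorder_exist_zero[OF eta_holomorphic open_UNIV connected_UNIV UNIV_I, of \<rho>] eta_2_neq_0
    by (metis UNIV_I)
  show eq: "zorder riemann_zeta \<rho> = zorder eta \<rho>"
  proof (rule zorder_eqI)
    show "open (ball \<rho> r \<inter> {s. Re s < 1})"
      by (intro open_Int open_ball open_Collect_less continuous_intros)
    show "(\<lambda>w. zor_poly eta \<rho> w / (1 - 2 powr (1 - w))) holomorphic_on ball \<rho> r \<inter> {s. Re s < 1}"
      by (intro holomorphic_intros holomorphic_on_subset[OF r(2)]) (use two_powr_neq_1 in auto)
    show "zor_poly eta \<rho> \<rho> / (1 - 2 powr (1 - \<rho>)) \<noteq> 0"
      using r(1,4) two_powr_neq_1[OF \<rho>(2)] by auto
    show "riemann_zeta w = zor_poly eta \<rho> w / (1 - 2 powr (1 - w)) * (w - \<rho>) powi zorder eta \<rho>"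
      if "w \<in> ball \<rho> r \<inter> {s. Re s < 1}" for w
      using that r(3) r(4)[of w] zeta_cont_eq_eta[of w] by (simp add: riemann_zeta_eq power_int_def)
  qed (use r \<rho> in auto)
  show "zorder riemann_zeta \<rho> > 0" using eq r(3) by simp
qed

text \<open>The exponential lower bound in the number of zeros meets a polynomial upper bound in the
  height, so taking logarithms gives a logarithmic count. It is weakened to a square root, which
  still sums against the inverse square of the height.\<close>

lemma nontrivial_zeros_count:
  obtains K where "\<And>T Z. finite Z \<Longrightarrow> Z \<subseteq> nontrivial_zeros \<Longrightarrow> (\<And>\<rho>. \<rho> \<in> Z \<Longrightarrow> \<bar>Im \<rho> - T\<bar> \<le> 1 / 2) \<Longrightarrow>
    (\<Sum>\<rho>\<in>Z. real_of_int (zorder riemann_zeta \<rho>)) \<le> K * sqrt (\<bar>T\<bar> + 1)"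
proof -
  obtain C where C: "C > 0" "\<And>s. Re s \<ge> -5 \<Longrightarrow> norm (eta s) \<le> C * (norm s + 7) ^ 7"
    using eta_polynomial_bound by blast
  \<comment> \<open>The maximum with 1 makes \<open>ln D\<close> nonnegative, so it can be absorbed
    into the multiple of \<open>sqrt (\<bar>T\<bar> + 1)\<close>.\<close>
  define D where "D = max 1 (4 * C)"
  have D: "D \<ge> 1" "4 * C \<le> D" by (auto simp: D_def)
  define K where "K = (ln D + 7 * (2 * sqrt 16)) / ln 2"
  show ?thesis
  proof (rule that[of K])
    fix T Z assume Z: "finite Z" "Z \<subseteq> nontrivial_zeros" "\<And>\<rho>. \<rho> \<in> Z \<Longrightarrow> \<bar>Im \<rho> - T\<bar> \<le> 1 / 2"
    define c where "c = Complex 2 T"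
    let ?n = "\<Sum>\<rho>\<in>Z. nat (zorder eta \<rho>)"
    \<comment> \<open>On the circle \<open>norm s \<le> 2 + \<bar>T\<bar> + 6.3\<close>, and the
      growth bound adds 7; the total stays below \<open>\<bar>T\<bar> + 16\<close>.\<close>
    have "norm (eta c) * 2 ^ ?n \<le> C * (\<bar>T\<bar> + 16) ^ 7"
    \<comment> \<open>The zeros in question lie within
      \<open>sqrt (2\<^sup>2 + (1 / 2)\<^sup>2)\<close>, just below 2.1, of the centre
      \<open>2 + i T\<close>.\<close>
    proof (rule zero_count_bound[where r = "2.1"])
      show "Z \<subseteq> cball c 2.1"
      proof
        fix \<rho> assume "\<rho> \<in> Z"
        hence \<rho>: "0 < Re \<rho>" "Re \<rho> < 1" "\<bar>T - Im \<rho>\<bar> \<le> 1 / 2"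
          using Z(2) Z(3)[of \<rho>] by (auto simp: nontrivial_zeros_def abs_minus_commute)
        have "(Re (c - \<rho>))\<^sup>2 + (Im (c - \<rho>))\<^sup>2 \<le> 2\<^sup>2 + (1 / 2)\<^sup>2"
          using \<rho> by (intro add_mono abs_le_square_iff[THEN iffD1]) (auto simp: c_def)
        also have "\<dots> \<le> 2.1\<^sup>2" by (simp add: power2_eq_square)
        finally have "norm (c - \<rho>) \<le> 2.1"
          unfolding cmod_def by (intro real_le_lsqrt) auto
        thus "\<rho> \<in> cball c 2.1" by (simp add: dist_norm)
      qed
      show "eta c \<noteq> 0" using norm_eta_ge[of c] by (auto simp: c_def)
      fix s assume s: "dist c s = 3 * (2.1 :: real)"
      have "norm (s - c) = 6.3" using s by (simp add: dist_norm norm_minus_commute)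
      hence 1: "Re s \<ge> -5" "norm s \<le> norm c + 6.3"
        using abs_Re_le_cmod[of "s - c"] norm_triangle_sub[of s c] by (auto simp: c_def)
      have "norm c \<le> 2 + \<bar>T\<bar>" using cmod_le[of c] by (simp add: c_def)
      hence "C * (norm s + 7) ^ 7 \<le> C * (\<bar>T\<bar> + 16) ^ 7"
        using 1 C(1) by (intro mult_left_mono power_mono) auto
      thus "norm (eta s) \<le> C * (\<bar>T\<bar> + 16) ^ 7" using C(2)[OF 1(1)] by linarith
    qed (use Z eta_holomorphic in auto)
    moreover have "1 / 4 * 2 ^ ?n \<le> norm (eta c) * 2 ^ ?n"
      using norm_eta_ge[of c] by (intro mult_right_mono) (auto simp: c_def)
    ultimately have "2 ^ ?n \<le> 4 * C * (\<bar>T\<bar> + 16) ^ 7" by linarith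
    also have "\<dots> \<le> D * (\<bar>T\<bar> + 16) ^ 7"
      using D by (intro mult_right_mono) auto
    finally have "ln (2 ^ ?n) \<le> ln (D * (\<bar>T\<bar> + 16) ^ 7)"
      using D by (subst ln_le_cancel_iff) auto
    also have "\<dots> = ln D + 7 * ln (\<bar>T\<bar> + 16)"
      using D by (subst ln_mult) (auto simp: ln_realpow)
    finally have le: "real ?n * ln 2 \<le> ln D + 7 * ln (\<bar>T\<bar> + 16)"
      by (simp add: ln_realpow)
    have "ln (\<bar>T\<bar> + 16) \<le> 2 * sqrt 16 * sqrt (\<bar>T\<bar> + 1)"
    proof -
      have "ln (\<bar>T\<bar> + 16) = 2 * ln (sqrt (\<bar>T\<bar> + 16))" by (simp add: ln_sqrt)
      also have "\<dots> \<le> 2 * sqrt (\<bar>T\<bar> + 16)"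
        using ln_bound[of "sqrt (\<bar>T\<bar> + 16)"] by simp
      also have "sqrt (\<bar>T\<bar> + 16) \<le> sqrt (16 * (\<bar>T\<bar> + 1))" by (intro real_sqrt_le_mono) auto
      finally show ?thesis by (simp only: real_sqrt_mult mult.assoc)
    qed
    moreover have "ln D * 1 \<le> ln D * sqrt (\<bar>T\<bar> + 1)"
      using D by (intro mult_left_mono) auto
    ultimately have "real ?n * ln 2 \<le> ln D * sqrt (\<bar>T\<bar> + 1) + 7 * (2 * sqrt 16 * sqrt (\<bar>T\<bar> + 1))"
      using le by linarith
    also have "\<dots> = K * sqrt (\<bar>T\<bar> + 1) * ln 2"
      by (simp add: K_def field_simps)
    finally have "real ?n \<le> K * sqrt (\<bar>T\<bar> + 1)" by simp
    moreover have "real ?n = (\<Sum>\<rho>\<in>Z. real_of_int (zorder riemann_zeta \<rho>))"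
      unfolding of_nat_sum
    proof (intro sum.cong refl)
      fix \<rho> assume "\<rho> \<in> Z"
      thus "real (nat (zorder eta \<rho>)) = real_of_int (zorder riemann_zeta \<rho>)"
        using zorder_riemann_zeta[of \<rho>] Z(2) by auto
    qed
    ultimately show "(\<Sum>\<rho>\<in>Z. real_of_int (zorder riemann_zeta \<rho>)) \<le> K * sqrt (\<bar>T\<bar> + 1)" by simp
  qed
qed

lemma nontrivial_zeros_strip:
  obtains K where "K \<ge> 0" "\<And>n Z. finite Z \<Longrightarrow> Z \<subseteq> nontrivial_zeros \<Longrightarrow> (\<And>\<rho>. \<rho> \<in> Z \<Longrightarrow> nat \<lfloor>\<bar>Im \<rho>\<bar>\<rfloor> = n) \<Longrightarrow>
    (\<Sum>\<rho>\<in>Z. real_of_int (zorder riemann_zeta \<rho>)) \<le> K * sqrt (real (Suc n))"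
proof -
  obtain K where K: "\<And>T Z. finite Z \<Longrightarrow> Z \<subseteq> nontrivial_zeros \<Longrightarrow> (\<And>\<rho>. \<rho> \<in> Z \<Longrightarrow> \<bar>Im \<rho> - T\<bar> \<le> 1 / 2) \<Longrightarrow>
    (\<Sum>\<rho>\<in>Z. real_of_int (zorder riemann_zeta \<rho>)) \<le> K * sqrt (\<bar>T\<bar> + 1)"
    using nontrivial_zeros_count by blast
  \<comment> \<open>The empty set of zeros already forces nonnegativity.\<close>
  have K0: "K \<ge> 0" using K[of "{}" 0] by simp
  show ?thesis
  proof (rule that[of "2 * (K * sqrt 2)"])
    fix n Z assume Z: "finite Z" "Z \<subseteq> nontrivial_zeros" "\<And>\<rho>. \<rho> \<in> Z \<Longrightarrow> nat \<lfloor>\<bar>Im \<rho>\<bar>\<rfloor> = n"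
    have n: "real n \<le> \<bar>Im \<rho>\<bar>" "\<bar>Im \<rho>\<bar> < real n + 1" if "\<rho> \<in> Z" for \<rho>
      using Z(3)[OF that] by linarith+
    \<comment> \<open>The midpoint of the bucket from \<open>n\<close> to \<open>n + 1\<close>:
      windows of half-width 1/2 around \<open>T\<close> and \<open>- T\<close> cover both signs of
      \<open>Im \<rho>\<close>. The factor \<open>sqrt 2\<close> comes from
      \<open>\<bar>T\<bar> + 1 \<le> 2 * Suc n\<close>.\<close>
    define T where "T = real n + 1 / 2"
    have "K * sqrt (\<bar>T\<bar> + 1) \<le> K * sqrt (2 * real (Suc n))"
      using K0 by (intro mult_left_mono real_sqrt_le_mono) (auto simp: T_def)
    hence T: "K * sqrt (\<bar>T\<bar> + 1) \<le> K * sqrt 2 * sqrt (real (Suc n))"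
      by (simp only: real_sqrt_mult mult.assoc)
    have "(\<Sum>\<rho>\<in>Z. real_of_int (zorder riemann_zeta \<rho>))
        = (\<Sum>\<rho>\<in>Z \<inter> {\<rho>. Im \<rho> \<ge> 0}. real_of_int (zorder riemann_zeta \<rho>)) +
          (\<Sum>\<rho>\<in>Z - {\<rho>. Im \<rho> \<ge> 0}. real_of_int (zorder riemann_zeta \<rho>))"
      using Z(1) by (rule sum.Int_Diff)
    also have "\<dots> \<le> K * sqrt (\<bar>T\<bar> + 1) + K * sqrt (\<bar>- T\<bar> + 1)"
    proof (intro add_mono K)
      show "\<bar>Im \<rho> - T\<bar> \<le> 1 / 2" if "\<rho> \<in> Z \<inter> {\<rho>. Im \<rho> \<ge> 0}" for \<rho>
        using that n[of \<rho>] unfolding T_def abs_le_iff by auto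
      show "\<bar>Im \<rho> - - T\<bar> \<le> 1 / 2" if "\<rho> \<in> Z - {\<rho>. Im \<rho> \<ge> 0}" for \<rho>
        using that n[of \<rho>] unfolding T_def abs_le_iff by auto
    qed (use Z in auto)
    finally show "(\<Sum>\<rho>\<in>Z. real_of_int (zorder riemann_zeta \<rho>)) \<le> 2 * (K * sqrt 2) * sqrt (real (Suc n))"
      using T by simp
  qed (use K0 in simp)
qed

text \<open>Multiplicities are at least 1, so the weighted count bounds the cardinality of every
  finite subset of a bucket, and a bounded height meets finitely many buckets.\<close>

lemma finite_nontrivial_zeros: "finite {\<rho>\<in>nontrivial_zeros. \<bar>Im \<rho>\<bar> \<le> R}"
proof -
  obtain K where K: "\<And>n Z. finite Z \<Longrightarrow> Z \<subseteq> nontrivial_zeros \<Longrightarrow> (\<And>\<rho>. \<rho> \<in> Z \<Longrightarrow> nat \<lfloor>\<bar>Im \<rho>\<bar>\<rfloor> = n) \<Longrightarrow>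
    (\<Sum>\<rho>\<in>Z. real_of_int (zorder riemann_zeta \<rho>)) \<le> K * sqrt (real (Suc n))"
    using nontrivial_zeros_strip by blast
  have "finite {\<rho>\<in>nontrivial_zeros. nat \<lfloor>\<bar>Im \<rho>\<bar>\<rfloor> = n}" for n
  proof (rule finite_if_finite_subsets_card_bdd[of _ "nat \<lceil>K * sqrt (real (Suc n))\<rceil>", THEN conjunct1])
    fix Z assume Z: "Z \<subseteq> {\<rho>\<in>nontrivial_zeros. nat \<lfloor>\<bar>Im \<rho>\<bar>\<rfloor> = n}" "finite Z"
    have "real (card Z) = (\<Sum>\<rho>\<in>Z. 1)" by simp
    also have "\<dots> \<le> (\<Sum>\<rho>\<in>Z. real_of_int (zorder riemann_zeta \<rho>))"
      using zorder_riemann_zeta(2) Z(1) by (intro sum_mono) fastforce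
    also have "\<dots> \<le> K * sqrt (real (Suc n))" using Z by (intro K) auto
    finally show "card Z \<le> nat \<lceil>K * sqrt (real (Suc n))\<rceil>" by linarith
  qed
  hence "finite (\<Union>n\<in>{..nat \<lfloor>R\<rfloor>}. {\<rho>\<in>nontrivial_zeros. nat \<lfloor>\<bar>Im \<rho>\<bar>\<rfloor> = n})" by blast
  moreover have "{\<rho>\<in>nontrivial_zeros. \<bar>Im \<rho>\<bar> \<le> R} \<subseteq> \<dots>"
    by (auto intro!: nat_mono floor_mono)
  ultimately show ?thesis by (rule finite_subset[rotated])
qed

text \<open>Grouped by the integer part of the height, the zeros of bucket \<open>n\<close>
  contribute at most \<open>K * sqrt (Suc n) / (Suc n)\<^sup>2\<close>, which is the exponent
  \<open>-3/2\<close>.\<close>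

lemma summable_nontrivial_zeros:
  "(\<lambda>\<rho>. real_of_int (zorder riemann_zeta \<rho>) / (1 + \<bar>Im \<rho>\<bar>)\<^sup>2) summable_on nontrivial_zeros"
proof (rule nonneg_bdd_above_summable_on)
  let ?f = "\<lambda>\<rho>. real_of_int (zorder riemann_zeta \<rho>) / (1 + \<bar>Im \<rho>\<bar>)\<^sup>2"
  let ?b = "\<lambda>\<rho>. nat \<lfloor>\<bar>Im \<rho>\<bar>\<rfloor>"
  show "?f \<rho> \<ge> 0" if "\<rho> \<in> nontrivial_zeros" for \<rho>
    using zorder_riemann_zeta(2)[OF that] by simp
  obtain K where K0: "K \<ge> 0" and K: "\<And>n Z. finite Z \<Longrightarrow> Z \<subseteq> nontrivial_zeros \<Longrightarrow> (\<And>\<rho>. \<rho> \<in> Z \<Longrightarrow> ?b \<rho> = n) \<Longrightarrow>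
    (\<Sum>\<rho>\<in>Z. real_of_int (zorder riemann_zeta \<rho>)) \<le> K * sqrt (real (Suc n))"
    using nontrivial_zeros_strip by blast
  have S: "summable (\<lambda>n. K * real (Suc n) powr (-3/2))"
    by (intro summable_mult summable_Suc_powr) auto
  have "sum ?f F \<le> (\<Sum>n. K * real (Suc n) powr (-3/2))" if F: "F \<subseteq> nontrivial_zeros" "finite F" for F
  proof -
    have "sum ?f F = (\<Sum>n\<in>?b ` F. \<Sum>\<rho>\<in>{\<rho>\<in>F. ?b \<rho> = n}. ?f \<rho>)"
      using F by (intro sum.image_gen)
    also have "\<dots> \<le> (\<Sum>n\<in>?b ` F. K * real (Suc n) powr (-3/2))"
    proof (rule sum_mono)
      fix n
      have "(\<Sum>\<rho>\<in>{\<rho>\<in>F. ?b \<rho> = n}. ?f \<rho>) \<le> (\<Sum>\<rho>\<in>{\<rho>\<in>F. ?b \<rho> = n}. real_of_int (zorder riemann_zeta \<rho>) / (real (Suc n))\<^sup>2)"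
      proof (rule sum_mono)
        fix \<rho> assume \<rho>: "\<rho> \<in> {\<rho>\<in>F. ?b \<rho> = n}"
        hence "real (Suc n) \<le> 1 + \<bar>Im \<rho>\<bar>" by simp linarith
        hence "(real (Suc n))\<^sup>2 \<le> (1 + \<bar>Im \<rho>\<bar>)\<^sup>2" by (intro power_mono) auto
        thus "?f \<rho> \<le> real_of_int (zorder riemann_zeta \<rho>) / (real (Suc n))\<^sup>2"
          using zorder_riemann_zeta(2)[of \<rho>] F \<rho> by (intro divide_left_mono) auto
      qed
      also have "\<dots> \<le> K * sqrt (real (Suc n)) / (real (Suc n))\<^sup>2"
        unfolding sum_divide_distrib[symmetric] using F by (intro divide_right_mono K) auto
      also have "\<dots> = K * (real (Suc n) powr (1/2) / real (Suc n) powr (real 2))"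
        by (subst powr_realpow) (auto simp: powr_half_sqrt)
      also have "\<dots> = K * real (Suc n) powr (-3/2)"
        by (subst powr_diff[symmetric]) auto
      finally show "(\<Sum>\<rho>\<in>{\<rho>\<in>F. ?b \<rho> = n}. ?f \<rho>) \<le> K * real (Suc n) powr (-3/2)" .
    qed
    also have "\<dots> \<le> (\<Sum>n. K * real (Suc n) powr (-3/2))"
      using F K0 by (intro sum_le_suminf S) auto
    finally show ?thesis .
  qed
  thus "bdd_above (sum ?f ` {F. F \<subseteq> nontrivial_zeros \<and> finite F})"
    by (intro bdd_aboveI[of _ "\<Sum>n. K * real (Suc n) powr (-3/2)"]) auto
qed

lemma real_nontrivial_zero_False: "of_real x \<notin> nontrivial_zeros"
  using zeta_cont_real_neq_0[of x] by (auto simp: nontrivial_zeros_def riemann_zeta_eq)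

section \<open>Exponential sums of subexponential growth\<close>

lemma holomorphic_infsum:
  fixes f :: "'a \<Rightarrow> complex \<Rightarrow> complex"
  assumes "open S" and hol: "\<And>w. w \<in> A \<Longrightarrow> f w holomorphic_on S"
    and bd: "\<And>w z. w \<in> A \<Longrightarrow> z \<in> S \<Longrightarrow> norm (f w z) \<le> M w" and "M summable_on A"
  shows "(\<lambda>z. \<Sum>\<^sub>\<infinity>w\<in>A. f w z) holomorphic_on S"
proof -
  have lim: "uniform_limit S (\<lambda>X z. \<Sum>w\<in>X. f w z) (\<lambda>z. \<Sum>\<^sub>\<infinity>w\<in>A. f w z) (finite_subsets_at_top A)"
    by (rule Weierstrass_m_test_general) (use bd \<open>M summable_on A\<close> in auto)
  have "(\<lambda>z. \<Sum>\<^sub>\<infinity>w\<in>A. f w z) field_differentiable (at z)" if z: "z \<in> S" for z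
  proof -
    obtain r where r: "r > 0" "cball z r \<subseteq> S"
      using \<open>open S\<close> z open_contains_cball by blast
    have "(\<lambda>z. \<Sum>\<^sub>\<infinity>w\<in>A. f w z) holomorphic_on ball z r"
    proof (rule holomorphic_uniform_limit)
      show "\<forall>\<^sub>F X in finite_subsets_at_top A. continuous_on (cball z r) (\<lambda>z. \<Sum>w\<in>X. f w z) \<and>
          (\<lambda>z. \<Sum>w\<in>X. f w z) holomorphic_on ball z r"
      proof (rule eventually_finite_subsets_at_top_weakI)
        fix X assume "finite X" "X \<subseteq> A"
        hence "(\<lambda>z. \<Sum>w\<in>X. f w z) holomorphic_on S" by (intro holomorphic_on_sum hol) auto
        moreover have "ball z r \<subseteq> S" by (rule order.trans[OF ball_subset_cball r(2)])
        ultimately show "continuous_on (cball z r) (\<lambda>z. \<Sum>w\<in>X. f w z) \<and>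
            (\<lambda>z. \<Sum>w\<in>X. f w z) holomorphic_on ball z r"
          using r(2) by (auto intro: continuous_on_subset[OF holomorphic_on_imp_continuous_on] holomorphic_on_subset)
      qed
    qed (use uniform_limit_on_subset[OF lim r(2)] in auto)
    thus ?thesis using r(1) holomorphic_on_imp_differentiable_at[of _ "ball z r" z] by simp
  qed
  thus ?thesis by (simp add: holomorphic_on_def field_differentiable_at_within)
qed

text \<open>The exponent itself is the index and \<open>c\<close> vanishes off the spectrum, so
  superposing or reflecting such sums is an operation on coefficient functions.\<close>

definition exp_sum :: "(complex \<Rightarrow> complex) \<Rightarrow> real \<Rightarrow> complex" where
  "exp_sum c t = (\<Sum>\<^sub>\<infinity>w. c w * exp (w * of_real t))"

lemma exp_sum_mult_exp: "exp_sum c t * exp (- z * of_real t) = (\<Sum>\<^sub>\<infinity>w. c w * exp ((w - z) * of_real t))"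
  unfolding exp_sum_def
  by (subst infsum_cmult_left'[symmetric]) (simp add: algebra_simps exp_diff exp_minus field_simps)

lemma uniform_limit_exp_sum:
  fixes c :: "complex \<Rightarrow> complex"
  assumes sum: "(\<lambda>w. norm (c w)) summable_on UNIV" and \<sigma>: "\<And>w. c w \<noteq> 0 \<Longrightarrow> Re w \<le> \<sigma>"
  shows "uniform_limit {0..b} (\<lambda>X t. \<Sum>w\<in>X. c w * exp ((w - z) * of_real t))
    (\<lambda>t. exp_sum c t * exp (- z * of_real t)) (finite_subsets_at_top UNIV)"
  unfolding exp_sum_mult_exp
proof (rule Weierstrass_m_test_general)
  show "(\<lambda>w. norm (c w) * exp (\<bar>\<sigma> - Re z\<bar> * b)) summable_on UNIV"
    by (rule summable_on_cmult_left[OF sum])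
  fix w t assume t: "t \<in> {0..b}"
  show "norm (c w * exp ((w - z) * of_real t)) \<le> norm (c w) * exp (\<bar>\<sigma> - Re z\<bar> * b)"
  proof (cases "c w = 0")
    case False
    have "(Re w - Re z) * t \<le> \<bar>\<sigma> - Re z\<bar> * b"
    proof -
      have "(Re w - Re z) * t \<le> \<bar>\<sigma> - Re z\<bar> * t"
        using t \<sigma>[OF False] by (intro mult_right_mono) auto
      also have "\<dots> \<le> \<bar>\<sigma> - Re z\<bar> * b"
        using t by (intro mult_left_mono) auto
      finally show ?thesis .
    qed
    thus ?thesis by (simp add: norm_mult mult_left_mono)
  qed simp
qed

lemma continuous_on_exp_sum:
  assumes "(\<lambda>w. norm (c w)) summable_on UNIV" "\<And>w. c w \<noteq> 0 \<Longrightarrow> Re w \<le> \<sigma>"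
  shows "continuous_on {0..b} (exp_sum c)"
proof -
  have "continuous_on {0..b} (\<lambda>t. exp_sum c t * exp (- 0 * of_real t))"
    by (rule uniform_limit_theorem[OF _ uniform_limit_exp_sum[OF assms]])
      (auto intro!: always_eventually continuous_intros)
  thus ?thesis by simp
qed

text \<open>Uniform convergence on the compact interval permits termwise integration, and each
  exponential has an explicit primitive; \<open>Re z > \<sigma>\<close> keeps \<open>z\<close> off
  the exponents.\<close>

lemma has_sum_integral_exp_sum:
  assumes c: "(\<lambda>w. norm (c w)) summable_on UNIV" "\<And>w. c w \<noteq> 0 \<Longrightarrow> Re w \<le> \<sigma>"
    and z: "Re z > \<sigma>" and "b \<ge> 0"
  shows "((\<lambda>w. c w * ((1 - exp ((w - z) * of_real b)) / (z - w))) has_sum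
    integral {0..b} (\<lambda>t. exp_sum c t * exp (- z * of_real t))) UNIV"
proof -
  let ?f = "\<lambda>X t. \<Sum>w\<in>X. c w * exp ((w - z) * complex_of_real t)"
  let ?g = "\<lambda>t. exp_sum c t * exp (- z * complex_of_real t)"
  have cont: "continuous_on {0..b} (?f X)" for X by (intro continuous_intros)
  have ne: "finite_subsets_at_top (UNIV :: complex set) \<noteq> bot" by simp
  obtain I J where I: "\<And>X. (?f X has_integral I X) {0..b}" and J: "(?g has_integral J) {0..b}"
    and lim: "(I \<longlongrightarrow> J) (finite_subsets_at_top UNIV)"
  proof (rule uniform_limit_integral[OF uniform_limit_exp_sum[OF c] cont ne])
    fix I J
    assume "\<And>X. (?f X has_integral I X) {0..b}" "(?g has_integral J) {0..b}"
      "(I \<longlongrightarrow> J) (finite_subsets_at_top UNIV)"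
    from that[OF this] show thesis .
  qed
  have "I X = (\<Sum>w\<in>X. c w * ((1 - exp ((w - z) * of_real b)) / (z - w)))" if "finite X" for X
  proof -
    have "((\<lambda>t. c w * exp ((w - z) * complex_of_real t)) has_integral
        c w * ((1 - exp ((w - z) * of_real b)) / (z - w))) {0..b}" for w
    proof (cases "c w = 0")
      case False
      hence "w \<noteq> z" using c(2)[of w] z by auto
      have "((\<lambda>t. exp ((w - z) * complex_of_real t)) has_integral
          exp ((w - z) * of_real b) / (w - z) - exp ((w - z) * of_real 0) / (w - z)) {0..b}"
      proof (rule fundamental_theorem_of_calculus[OF \<open>b \<ge> 0\<close>])
        fix t
        have "((\<lambda>u. exp ((w - z) * u) / (w - z)) has_field_derivative exp ((w - z) * of_real t)) (at (of_real t))"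
          using \<open>w \<noteq> z\<close> by (auto intro!: derivative_eq_intros)
        thus "((\<lambda>t. exp ((w - z) * complex_of_real t) / (w - z)) has_vector_derivative
            exp ((w - z) * of_real t)) (at t within {0..b})"
          by (rule has_vector_derivative_at_within[OF has_vector_derivative_real_field])
      qed
      hence "((\<lambda>t. c w * exp ((w - z) * complex_of_real t)) has_integral
          c w * (exp ((w - z) * of_real b) / (w - z) - exp ((w - z) * of_real 0) / (w - z))) {0..b}"
        by (rule has_integral_mult_right)
      moreover have "exp ((w - z) * of_real b) / (w - z) - exp ((w - z) * of_real 0) / (w - z) =
          (1 - exp ((w - z) * of_real b)) / (z - w)"
        using minus_divide_divide[of "exp ((w - z) * of_real b) - 1" "w - z"]
        by (simp add: diff_divide_distrib)
      ultimately show ?thesis by (simp only:)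
    qed simp
    hence "(?f X has_integral (\<Sum>w\<in>X. c w * ((1 - exp ((w - z) * of_real b)) / (z - w)))) {0..b}"
      by (intro has_integral_sum that)
    thus ?thesis by (rule has_integral_unique[OF I])
  qed
  hence "(sum (\<lambda>w. c w * ((1 - exp ((w - z) * of_real b)) / (z - w))) \<longlongrightarrow> J) (finite_subsets_at_top UNIV)"
    by (intro Lim_transform_eventually[OF lim] eventually_finite_subsets_at_top_weakI) auto
  thus ?thesis using integral_unique[OF J] by (simp add: has_sum_def)
qed

text \<open>The boundary terms at \<open>b\<close> have total norm at most the coefficient mass
  times \<open>exp (- \<delta> * b) / \<delta>\<close>, where \<open>\<delta>\<close> is the
  distance of \<open>Re z\<close> from the abscissa \<open>\<sigma>\<close>.\<close>

lemma tendsto_laplace_exp_sum: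
  assumes c: "(\<lambda>w. norm (c w)) summable_on UNIV" "\<And>w. c w \<noteq> 0 \<Longrightarrow> Re w \<le> \<sigma>"
    and z: "Re z > \<sigma>"
  shows "(\<lambda>n. integral {0..real n} (\<lambda>t. exp_sum c t * exp (- z * of_real t))) \<longlonglongrightarrow> (\<Sum>\<^sub>\<infinity>w. c w / (z - w))"
proof -
  define \<delta> where "\<delta> = Re z - \<sigma>"
  have "\<delta> > 0" using z by (simp add: \<delta>_def)
  have dist: "norm (z - w) \<ge> \<delta>" if "c w \<noteq> 0" for w
    using c(2)[OF that] abs_Re_le_cmod[of "z - w"] by (simp add: \<delta>_def)
  have e: "norm (c w * exp ((w - z) * of_real b) / (z - w)) \<le> norm (c w) * (exp (- \<delta> * b) / \<delta>)"
    if "b \<ge> 0" for w b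
  proof (cases "c w = 0")
    case False
    have "(Re w - Re z) * b \<le> - \<delta> * b"
      using c(2)[OF False] that by (intro mult_right_mono) (auto simp: \<delta>_def)
    hence "exp ((Re w - Re z) * b) / norm (z - w) \<le> exp (- \<delta> * b) / \<delta>"
      using dist[OF False] \<open>\<delta> > 0\<close> by (intro frac_le) auto
    thus ?thesis
      by (simp add: norm_mult norm_divide mult_left_mono times_divide_eq_right[symmetric] del: times_divide_eq_right)
  qed simp
  have sum_e: "(\<lambda>w. norm (c w * exp ((w - z) * of_real b) / (z - w))) summable_on UNIV" if "b \<ge> 0" for b
    by (rule summable_on_comparison_test[OF summable_on_cmult_left[OF c(1), of "exp (- \<delta> * b) / \<delta>"] e[OF that]]) auto
  have S: "(\<lambda>w. c w / (z - w)) summable_on UNIV"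
    using abs_summable_summable[OF sum_e[of 0]] by simp
  have diff: "norm (integral {0..b} (\<lambda>t. exp_sum c t * exp (- z * of_real t)) - (\<Sum>\<^sub>\<infinity>w. c w / (z - w)))
      \<le> (\<Sum>\<^sub>\<infinity>w. norm (c w)) * (exp (- \<delta> * b) / \<delta>)" if "b \<ge> 0" for b
  proof -
    have "((\<lambda>w. c w * ((1 - exp ((w - z) * of_real b)) / (z - w)) - c w / (z - w)) has_sum
        integral {0..b} (\<lambda>t. exp_sum c t * exp (- z * of_real t)) - (\<Sum>\<^sub>\<infinity>w. c w / (z - w))) UNIV"
      using has_sum_add[OF has_sum_integral_exp_sum[OF c z that] has_sum_uminusI[OF has_sum_infsum[OF S]]] by simp
    also have "(\<lambda>w. c w * ((1 - exp ((w - z) * of_real b)) / (z - w)) - c w / (z - w)) =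
        (\<lambda>w. - (c w * exp ((w - z) * of_real b) / (z - w)))"
      by (simp add: fun_eq_iff right_diff_distrib diff_divide_distrib)
    finally have "integral {0..b} (\<lambda>t. exp_sum c t * exp (- z * of_real t)) - (\<Sum>\<^sub>\<infinity>w. c w / (z - w))
        = (\<Sum>\<^sub>\<infinity>w. - (c w * exp ((w - z) * of_real b) / (z - w)))"
      by (simp add: infsumI)
    also have "norm \<dots> \<le> (\<Sum>\<^sub>\<infinity>w. norm (- (c w * exp ((w - z) * of_real b) / (z - w))))"
      by (rule norm_infsum_bound) (use sum_e[OF that] in simp)
    also have "\<dots> \<le> (\<Sum>\<^sub>\<infinity>w. norm (c w) * (exp (- \<delta> * b) / \<delta>))"
      by (rule infsum_mono[OF _ summable_on_cmult_left[OF c(1)]]) (use sum_e[OF that] e[OF that] in simp_all)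
    also have "\<dots> = (\<Sum>\<^sub>\<infinity>w. norm (c w)) * (exp (- \<delta> * b) / \<delta>)"
      by (rule infsum_cmult_left')
    finally show ?thesis .
  qed
  have "(\<lambda>n. exp (- \<delta>) ^ n) \<longlonglongrightarrow> 0"
    using \<open>\<delta> > 0\<close> by (intro LIMSEQ_power_zero) auto
  hence "(\<lambda>n. exp (- \<delta> * real n)) \<longlonglongrightarrow> 0"
    by (simp add: exp_of_nat2_mult[symmetric])
  hence "(\<lambda>n. (\<Sum>\<^sub>\<infinity>w. norm (c w)) * (exp (- \<delta> * real n) / \<delta>)) \<longlonglongrightarrow> (\<Sum>\<^sub>\<infinity>w. norm (c w)) * (0 / \<delta>)"
    using \<open>\<delta> > 0\<close> by (intro tendsto_intros) auto
  hence "(\<lambda>n. (\<Sum>\<^sub>\<infinity>w. norm (c w)) * (exp (- \<delta> * real n) / \<delta>)) \<longlonglongrightarrow> 0" by simp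
  hence "(\<lambda>n. integral {0..real n} (\<lambda>t. exp_sum c t * exp (- z * of_real t)) - (\<Sum>\<^sub>\<infinity>w. c w / (z - w))) \<longlonglongrightarrow> 0"
    by (rule Lim_null_comparison[rotated]) (use diff in \<open>auto intro!: always_eventually\<close>)
  thus ?thesis by (simp add: LIM_zero_iff)
qed

text \<open>Cutting the half-line into unit intervals makes the transform a series of entire
  functions, each obtained by differentiating under a compact integral, with a geometric majorant on
  every half-plane \<open>Re z \<ge> \<delta>\<close>.\<close>

lemma laplace_holomorphic:
  fixes h :: "real \<Rightarrow> complex"
  assumes cont: "\<And>b. continuous_on {0..b} h"
    and growth: "\<And>\<epsilon>. \<epsilon> > 0 \<Longrightarrow> \<exists>B. \<forall>t\<ge>0. norm (h t) \<le> B * exp (\<epsilon> * t)"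
  obtains F where "F holomorphic_on {z. Re z > 0}"
    "\<And>z. Re z > 0 \<Longrightarrow> (\<lambda>n. integral {0..real n} (\<lambda>t. h t * exp (- z * of_real t))) \<longlonglongrightarrow> F z"
proof -
  define I where "I = (\<lambda>n z. integral {real n..real (Suc n)} (\<lambda>t. h t * exp (- z * of_real t)))"
  have conth: "continuous_on {real n..real (Suc n)} h" for n
    by (rule continuous_on_subset[OF cont[of "real (Suc n)"]]) auto
  have bound: "\<exists>M. summable M \<and> (\<forall>n z. Re z \<ge> \<delta> \<longrightarrow> norm (I n z) \<le> M n)" if \<delta>: "\<delta> > 0" for \<delta>
  proof -
    \<comment> \<open>Allowing growth at half the rate \<open>\<delta>\<close> leaves a net decay
      \<open>exp (- \<delta> / 2 * t)\<close> of the integrand.\<close>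
    obtain B where B: "\<And>t. t \<ge> 0 \<Longrightarrow> norm (h t) \<le> B * exp (\<delta> / 2 * t)"
      using growth[of "\<delta> / 2"] \<delta> by auto
    have B0: "B \<ge> 0" using B[of 0] norm_ge_zero[of "h 0"] by (simp del: norm_ge_zero)
    have "norm (I n z) \<le> B * exp (- \<delta> / 2) ^ n" if z: "Re z \<ge> \<delta>" for n z
    proof -
      have "norm (I n z) \<le> B * exp (- \<delta> / 2) ^ n * (real (Suc n) - real n)"
        unfolding I_def
      proof (rule integral_bound)
        show "continuous_on {real n..real (Suc n)} (\<lambda>t. h t * exp (- z * of_real t))"
          by (intro continuous_intros conth)
        fix t assume t: "t \<in> {real n..real (Suc n)}"
        have "norm (h t * exp (- z * of_real t)) \<le> B * exp (\<delta> / 2 * t) * exp (- Re z * t)"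
          using B[of t] t by (simp add: norm_mult mult_right_mono)
        also have "\<dots> \<le> B * exp (\<delta> / 2 * t) * exp (- \<delta> * t)"
          using z t B0 by (intro mult_left_mono) (auto intro: mult_right_mono)
        also have "\<dots> = B * exp (- \<delta> / 2 * t)" by (simp add: exp_add[symmetric])
        also have "\<dots> \<le> B * exp (- \<delta> / 2 * real n)"
          using t \<open>\<delta> > 0\<close> B0 by (intro mult_left_mono) auto
        also have "exp (- \<delta> / 2 * real n) = exp (- \<delta> / 2) ^ n"
          by (simp add: exp_of_nat2_mult[symmetric])
        finally show "norm (h t * exp (- z * of_real t)) \<le> B * exp (- \<delta> / 2) ^ n" .
      qed simp
      thus ?thesis by simp
    qed
    moreover have "summable (\<lambda>n. B * exp (- \<delta> / 2) ^ n)"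
      using \<delta> by (intro summable_mult summable_geometric) auto
    ultimately show ?thesis by (intro exI[of _ "\<lambda>n. B * exp (- \<delta> / 2) ^ n"]) simp
  qed
  have "I n holomorphic_on UNIV" for n
    unfolding I_def box_real(2)[symmetric]
  proof (rule leibniz_rule_holomorphic)
    show "((\<lambda>z. h t * exp (- z * of_real t)) has_field_derivative h t * (- of_real t * exp (- z * of_real t)))
        (at z within UNIV)" for z t
      by (auto intro!: derivative_eq_intros)
    show "(\<lambda>t. h t * exp (- z * of_real t)) integrable_on cbox (real n) (real (Suc n))" for z
      using conth by (intro integrable_continuous continuous_intros) auto
    show "continuous_on (UNIV \<times> cbox (real n) (real (Suc n)))
        (\<lambda>(z, t). h t * (- of_real t * exp (- z * of_real t)))"
      unfolding case_prod_beta
      by (intro continuous_intros continuous_on_compose2[OF conth[of n]]) auto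
  qed auto
  hence hol: "(\<lambda>z. \<Sum>n. I n z) holomorphic_on {z. Re z > 0}"
  proof (intro holomorphic_suminf)
    show "open {z. Re z > 0}" by (intro open_Collect_less continuous_intros)
    fix x assume "x \<in> {z. Re z > 0}"
    hence x: "Re x / 2 > 0" by simp
    from bound[OF x] obtain M
      where M: "summable M" "\<And>n z. Re z \<ge> Re x / 2 \<Longrightarrow> norm (I n z) \<le> M n" by auto
    have "Re y \<ge> Re x / 2" if "y \<in> ball x (Re x / 2)" for y
      using that abs_Re_le_cmod[of "x - y"] by (simp add: dist_norm)
    thus "\<exists>d>0. \<exists>M. summable M \<and> (\<forall>n. \<forall>y\<in>ball x d \<inter> {z. Re z > 0}. norm (I n y) \<le> M n)"
      using x M by (intro exI[of _ "Re x / 2"] exI[of _ M] conjI allI ballI) auto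
  qed (auto intro: holomorphic_on_subset)
  show ?thesis
  proof (rule that[OF hol])
    fix z :: complex assume z: "Re z > 0"
    from bound[OF z] obtain M where M: "summable M" "\<And>n. norm (I n z) \<le> M n" by auto
    have "(\<lambda>n. I n z) sums (\<Sum>n. I n z)"
      by (rule summable_sums, rule summable_comparison_test'[OF M(1)]) (rule M(2))
    moreover have "(\<Sum>k<n. I k z) = integral {0..real n} (\<lambda>t. h t * exp (- z * of_real t))" for n
    proof (induction n)
      case (Suc n)
      have "(\<Sum>k<Suc n. I k z) = integral {0..real n} (\<lambda>t. h t * exp (- z * of_real t)) +
          integral {real n..real (Suc n)} (\<lambda>t. h t * exp (- z * of_real t))"
        using Suc by (simp add: I_def)
      also have "\<dots> = integral {0..real (Suc n)} (\<lambda>t. h t * exp (- z * of_real t))"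
        by (rule Henstock_Kurzweil_Integration.integral_combine)
          (auto intro!: integrable_continuous_interval continuous_intros cont)
      finally show ?case .
    qed simp
    ultimately show "(\<lambda>n. integral {0..real n} (\<lambda>t. h t * exp (- z * of_real t))) \<longlonglongrightarrow> (\<Sum>n. I n z)"
      by (simp add: sums_def)
  qed
qed

text \<open>Local finiteness isolates the candidate pole: in a disc only finitely many terms are
  singular, and the remaining ones sum to a holomorphic function by absolute summability. Distinct
  exponents give distinct poles, so the residue \<open>c w0\<close> survives.\<close>

lemma exp_sum_exponents_le_0:
  fixes c :: "complex \<Rightarrow> complex"
  assumes c: "(\<lambda>w. norm (c w)) summable_on UNIV" "\<And>w. c w \<noteq> 0 \<Longrightarrow> Re w \<le> \<sigma>"
    and fin: "\<And>R. finite {w. c w \<noteq> 0 \<and> norm w \<le> R}"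
    and growth: "\<And>\<epsilon>. \<epsilon> > 0 \<Longrightarrow> \<exists>B. \<forall>t\<ge>0. norm (exp_sum c t) \<le> B * exp (\<epsilon> * t)"
    and w0: "c w0 \<noteq> 0"
  shows "Re w0 \<le> 0"
proof (rule ccontr)
  assume "\<not> Re w0 \<le> 0"
  hence pos: "Re w0 > 0" "\<sigma> > 0" using c(2)[OF w0] by auto
  obtain F where F: "F holomorphic_on {z. Re z > 0}"
    "\<And>z. Re z > 0 \<Longrightarrow> (\<lambda>n. integral {0..real n} (\<lambda>t. exp_sum c t * exp (- z * of_real t))) \<longlonglongrightarrow> F z"
    using laplace_holomorphic[OF continuous_on_exp_sum[OF c] growth] by blast
  \<comment> \<open>The ball must contain both \<open>w0\<close> and the point
    \<open>\<sigma> + 1\<close>, which lies where the transform is known to equal the pole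
    sum.\<close>
  define R where "R = norm w0 + \<sigma> + 2"
  \<comment> \<open>One unit beyond the ball: every other exponent has distance at least 1 from it,
    so \<open>norm (c w)\<close> majorises the remaining terms.\<close>
  define K where "K = {w. c w \<noteq> 0 \<and> norm w \<le> R + 1}"
  define G where "G = (\<lambda>z. \<Sum>\<^sub>\<infinity>w\<in>-K. c w / (z - w))"
  define P where "P = (\<lambda>z. \<Prod>w\<in>K. z - w)"
  have K: "finite K" "w0 \<in> K" using fin[of "R + 1"] w0 pos by (auto simp: K_def R_def)
  have le: "norm (c w / (z - w)) \<le> norm (c w)" if "w \<in> - K" "z \<in> ball 0 R" for w z
  proof (cases "c w = 0")
    case False
    hence "norm (z - w) \<ge> 1"
      using that norm_triangle_sub[of w z] by (auto simp: K_def norm_minus_commute)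
    hence "norm (c w) / norm (z - w) \<le> norm (c w) / 1"
      by (intro divide_left_mono) auto
    thus ?thesis by (simp add: norm_divide)
  qed simp
  have c': "(\<lambda>w. norm (c w)) summable_on (- K)"
    by (rule summable_on_subset_banach[OF c(1)]) auto
  have G: "G holomorphic_on ball 0 R"
    unfolding G_def
  proof (rule holomorphic_infsum[OF open_ball _ le c'])
    fix w assume w: "w \<in> - K"
    show "(\<lambda>z. c w / (z - w)) holomorphic_on ball 0 R"
    proof (cases "c w = 0")
      case False
      thus ?thesis using w by (intro holomorphic_intros) (auto simp: K_def)
    qed simp
  qed
  \<comment> \<open>Multiplication by \<open>P\<close> clears the poles, so the identity extends
    over the convex half-disc to \<open>w0\<close>. There the left side vanishes, while the right
    side keeps only the term of \<open>w0\<close>.\<close>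
  have "(F w0 - G w0) * P w0 = (\<Sum>w\<in>K. c w * (\<Prod>u\<in>K - {w}. w0 - u))"
  proof (rule analytic_continuation_open[where s = "{z. Re z > \<sigma>} \<inter> ball 0 R" and s' = "{z. Re z > 0} \<inter> ball 0 R"
        and f = "\<lambda>z. (F z - G z) * P z" and g = "\<lambda>z. \<Sum>w\<in>K. c w * (\<Prod>u\<in>K - {w}. z - u)"])
    show "open ({z. Re z > \<sigma>} \<inter> ball 0 R)" "open ({z. Re z > 0} \<inter> ball 0 R)"
      by (intro open_Int open_ball open_Collect_less continuous_intros)+
    have "of_real (\<sigma> + 1) \<in> {z. Re z > \<sigma>} \<inter> ball 0 R"
      using pos by (simp add: R_def add_pos_nonneg del: of_real_add)
    thus "{z. Re z > \<sigma>} \<inter> ball 0 R \<noteq> {}" by blast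
    show "connected ({z. Re z > 0} \<inter> ball 0 R)"
      by (intro convex_connected convex_Int convex_halfspace_Re_gt convex_ball)
    show "(\<lambda>z. (F z - G z) * P z) holomorphic_on {z. Re z > 0} \<inter> ball 0 R"
      unfolding P_def
      by (intro holomorphic_intros holomorphic_on_subset[OF F(1)] holomorphic_on_subset[OF G]) auto
    show "w0 \<in> {z. Re z > 0} \<inter> ball 0 R" using pos by (auto simp: R_def)
    fix z assume z: "z \<in> {z. Re z > \<sigma>} \<inter> ball 0 R"
    have "F z = (\<Sum>\<^sub>\<infinity>w. c w / (z - w))"
      using z pos by (intro LIMSEQ_unique[OF F(2) tendsto_laplace_exp_sum[OF c]]) auto
    also have "\<dots> = (\<Sum>\<^sub>\<infinity>w\<in>K \<union> - K. c w / (z - w))" by simp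
    also have "\<dots> = (\<Sum>\<^sub>\<infinity>w\<in>K. c w / (z - w)) + G z"
      unfolding G_def
    proof (rule infsum_Un_disjoint)
      show "(\<lambda>w. c w / (z - w)) summable_on - K"
        by (rule abs_summable_summable, rule summable_on_comparison_test[OF c']) (use z le in auto)
    qed (use K in auto)
    also have "(\<Sum>\<^sub>\<infinity>w\<in>K. c w / (z - w)) = (\<Sum>w\<in>K. c w / (z - w))"
      using K by (simp add: infsum_finite)
    finally have "(F z - G z) * P z = (\<Sum>w\<in>K. c w / (z - w) * P z)"
      by (simp add: sum_distrib_right)
    also have "\<dots> = (\<Sum>w\<in>K. c w * (\<Prod>u\<in>K - {w}. z - u))"
    proof (rule sum.cong)
      fix w assume w: "w \<in> K"
      hence "z \<noteq> w" using z c(2)[of w] by (auto simp: K_def)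
      thus "c w / (z - w) * P z = c w * (\<Prod>u\<in>K - {w}. z - u)"
        using prod.remove[OF K(1) w, of "\<lambda>u. z - u"] by (simp add: P_def)
    qed simp
    finally show "(F z - G z) * P z = (\<Sum>w\<in>K. c w * (\<Prod>u\<in>K - {w}. z - u))" .
  qed (use pos in \<open>auto intro!: holomorphic_intros\<close>)
  moreover have "P w0 = 0" using K by (auto simp: P_def prod_zero_iff)
  moreover have "(\<Sum>w\<in>K. c w * (\<Prod>u\<in>K - {w}. w0 - u)) = c w0 * (\<Prod>u\<in>K - {w0}. w0 - u)"
  proof -
    have "(\<Prod>u\<in>K - {w}. w0 - u) = 0" if "w \<in> K - {w0}" for w
      using that K by (auto simp: prod_zero_iff)
    thus ?thesis using sum.remove[OF K, of "\<lambda>w. c w * (\<Prod>u\<in>K - {w}. w0 - u)"] by simp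
  qed
  ultimately show False using w0 K by (auto simp: prod_zero_iff)
qed

section \<open>Screw functions\<close>

lemma has_sum_finite_sum:
  fixes f :: "'i \<Rightarrow> 'a \<Rightarrow> 'b :: topological_comm_monoid_add"
  assumes "finite I" "\<And>i. i \<in> I \<Longrightarrow> (f i has_sum s i) A"
  shows "((\<lambda>x. \<Sum>i\<in>I. f i x) has_sum (\<Sum>i\<in>I. s i)) A"
  using assms by (induction I) (auto intro: has_sum_add)

lemma screw_function_cis_sum:
  fixes a \<gamma> :: "'a \<Rightarrow> real"
  assumes nonneg: "\<And>x. x \<in> A \<Longrightarrow> a x \<ge> 0" and sum: "a summable_on A"
  defines "S \<equiv> \<lambda>t. \<Sum>\<^sub>\<infinity>x\<in>A. complex_of_real (a x) * cis (\<gamma> x * t)"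
  shows "screw_function (\<lambda>t. S t - S 0)"
proof -
  have norm_le: "norm (complex_of_real (a x) * cis (\<gamma> x * t)) \<le> a x" if "x \<in> A" for x t
    using nonneg[OF that] by (simp add: norm_mult)
  have S: "((\<lambda>x. complex_of_real (a x) * cis (\<gamma> x * t)) has_sum S t) A" for t
    unfolding S_def
    by (rule has_sum_infsum, rule abs_summable_summable, rule summable_on_comparison_test[OF sum])
      (use norm_le in auto)
  have lim: "uniform_limit UNIV (\<lambda>X t. \<Sum>x\<in>X. complex_of_real (a x) * cis (\<gamma> x * t)) S (finite_subsets_at_top A)"
    unfolding S_def by (rule Weierstrass_m_test_general[OF norm_le sum])
  have "continuous_on UNIV S"
    by (rule uniform_limit_theorem[OF _ lim]) (auto intro!: always_eventually continuous_intros)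
  hence "continuous_on UNIV (\<lambda>t. S t - S 0)" by (intro continuous_intros)
  moreover have cnj: "S (- t) = cnj (S t)" for t
  proof -
    have "cnj (S t) = (\<Sum>\<^sub>\<infinity>x\<in>A. cnj (complex_of_real (a x) * cis (\<gamma> x * t)))"
      unfolding S_def by (rule infsum_cnj[symmetric])
    thus ?thesis by (simp add: S_def cis_cnj)
  qed
  moreover have "nonneg_definite_kernel (screw_kernel (\<lambda>t. S t - S 0))"
    unfolding nonneg_definite_kernel_def
  proof (intro allI impI)
    fix n :: nat and t :: "nat \<Rightarrow> real" and \<xi> :: "nat \<Rightarrow> complex"
    let ?e = "\<lambda>i x. cis (\<gamma> x * t i) - 1"
    let ?V = "\<Sum>i<n. \<Sum>j<n. screw_kernel (\<lambda>t. S t - S 0) (t i) (t j) * \<xi> i * cnj (\<xi> j)"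
    have "((\<lambda>x. complex_of_real (a x) * (?e i x * cnj (?e j x))) has_sum
        screw_kernel (\<lambda>t. S t - S 0) (t i) (t j)) A" for i j
    proof -
      have "((\<lambda>x. complex_of_real (a x) * cis (\<gamma> x * (t i - t j)) - complex_of_real (a x) * cis (\<gamma> x * t i)
          - complex_of_real (a x) * cis (\<gamma> x * (- t j)) + complex_of_real (a x) * cis (\<gamma> x * 0))
          has_sum (S (t i - t j) - S (t i) - S (- t j) + S 0)) A"
        unfolding diff_conv_add_uminus
        by (intro has_sum_add has_sum_uminusI S)
      moreover have "S (t i - t j) - S (t i) - S (- t j) + S 0 = screw_kernel (\<lambda>t. S t - S 0) (t i) (t j)"
        by (simp add: screw_kernel_def)
      moreover have "complex_of_real (a x) * cis (\<gamma> x * (t i - t j)) - complex_of_real (a x) * cis (\<gamma> x * t i)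
          - complex_of_real (a x) * cis (\<gamma> x * (- t j)) + complex_of_real (a x) * cis (\<gamma> x * 0)
          = complex_of_real (a x) * (?e i x * cnj (?e j x))" for x
      proof -
        have "cis (\<gamma> x * (t i - t j)) = cis (\<gamma> x * t i) * cis (- (\<gamma> x * t j))"
          by (simp add: cis_mult right_diff_distrib)
        thus ?thesis by (simp add: cis_cnj) (simp add: algebra_simps)
      qed
      ultimately show ?thesis by simp
    qed
    hence "((\<lambda>x. \<Sum>i<n. \<Sum>j<n. complex_of_real (a x) * (?e i x * cnj (?e j x)) * \<xi> i * cnj (\<xi> j)) has_sum ?V) A"
      by (intro has_sum_finite_sum has_sum_cmult_left) auto
    also have "(\<lambda>x. \<Sum>i<n. \<Sum>j<n. complex_of_real (a x) * (?e i x * cnj (?e j x)) * \<xi> i * cnj (\<xi> j)) =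
        (\<lambda>x. complex_of_real (a x * (norm (\<Sum>i<n. \<xi> i * ?e i x))\<^sup>2))"
    proof
      fix x
      have "(\<Sum>i<n. \<Sum>j<n. complex_of_real (a x) * (?e i x * cnj (?e j x)) * \<xi> i * cnj (\<xi> j)) =
          complex_of_real (a x) * ((\<Sum>i<n. \<xi> i * ?e i x) * cnj (\<Sum>i<n. \<xi> i * ?e i x))"
        unfolding cnj_sum sum_product unfolding sum_distrib_left
        by (intro sum.cong refl) (simp only: complex_cnj_mult mult_ac)
      also have "\<dots> = complex_of_real (a x * (norm (\<Sum>i<n. \<xi> i * ?e i x))\<^sup>2)"
        by (simp only: complex_norm_square[symmetric] of_real_mult)
      finally show "(\<Sum>i<n. \<Sum>j<n. complex_of_real (a x) * (?e i x * cnj (?e j x)) * \<xi> i * cnj (\<xi> j)) =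
          complex_of_real (a x * (norm (\<Sum>i<n. \<xi> i * ?e i x))\<^sup>2)" .
    qed
    finally have V: "((\<lambda>x. complex_of_real (a x * (norm (\<Sum>i<n. \<xi> i * ?e i x))\<^sup>2)) has_sum ?V) A" .
    have "Re ?V \<ge> 0" using has_sum_Re[OF V] by (rule has_sum_nonneg) (use nonneg in simp)
    moreover have "Im ?V = 0"
    proof -
      have "((\<lambda>x. 0) has_sum Im ?V) A"
        using has_sum_Im[OF V] by (simp only: Im_complex_of_real)
      thus ?thesis by (rule trans[OF infsumI[symmetric] infsum_0_simp])
    qed
    ultimately show "?V \<in> \<real>\<^sub>\<ge>\<^sub>0" by (simp add: complex_nonneg_Reals_iff)
  qed
  \<comment> \<open>\<open>S 0\<close> is real because \<open>S (- 0) = cnj (S 0)\<close>, so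
    subtracting it preserves the conjugate symmetry.\<close>
  ultimately show ?thesis using cnj[of 0] by (simp add: screw_function_def)
qed

text \<open>\<open>q t\<close> is the diagonal value of the kernel, hence nonnegative, and conjugate
  symmetry makes it the exact norm of \<open>g t + g (- t)\<close>. A factor 4 per doubling carries
  a bound on a compact interval to quadratic growth.\<close>

lemma screw_function_growth:
  assumes g: "screw_function g" "g 0 = 0"
  obtains M where "\<And>t. t \<ge> 0 \<Longrightarrow> norm (g t + g (- t)) \<le> M * (1 + t\<^sup>2)"
proof -
  define q where "q = (\<lambda>t. - Re (g t + g (- t)))"
  have cnj: "g (- t) = cnj (g t)" for t using g by (simp add: screw_function_def)
  have nonneg: "(\<Sum>i<n. \<Sum>j<n. screw_kernel g (t i) (t j) * \<xi> i * cnj (\<xi> j)) \<in> \<real>\<^sub>\<ge>\<^sub>0" if "n > 0" for n :: nat and t \<xi>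
    using g(1) that by (simp add: screw_function_def nonneg_definite_kernel_def)
  have q0: "q t \<ge> 0" for t
    using nonneg[of 1 "\<lambda>_. t" "\<lambda>_. 1"] g(2)
    by (simp add: screw_kernel_def q_def complex_nonneg_Reals_iff)
  have norm_q: "norm (g t + g (- t)) = q t" for t
  proof -
    have "g t + g (- t) = complex_of_real (- q t)"
      by (simp add: cnj q_def complex_eq_iff)
    thus ?thesis using q0[of t] by (simp only: norm_of_real abs_minus_cancel abs_of_nonneg)
  qed
  \<comment> \<open>Positivity at the points \<open>t\<close> and \<open>- t\<close> with equal
    weights: the diagonal entries give \<open>2 * q t\<close>, the mixed ones
    \<open>2 * q t - q (2 * t)\<close> in real part.\<close>
  have double: "q (2 * t) \<le> 4 * q t" for t
  proof -
    have "{..<2::nat} = {0, 1}" by auto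
    hence "Re (screw_kernel g t t + screw_kernel g t (- t) + (screw_kernel g (- t) t + screw_kernel g (- t) (- t))) \<ge> 0"
      using nonneg[of 2 "\<lambda>i. if i = 0 then t else - t" "\<lambda>_. 1"] by (simp add: complex_nonneg_Reals_iff)
    moreover have "t + t = 2 * t" "- t - t = - (2 * t)" by simp_all
    ultimately show ?thesis using g(2) by (simp add: screw_kernel_def q_def)
  qed
  have "continuous_on {0..1} q"
  proof -
    have "continuous_on UNIV g" using g by (simp add: screw_function_def)
    hence "continuous_on {0..1} g" "continuous_on {0..1} (\<lambda>t. g (- t))"
      by (auto intro: continuous_on_subset continuous_on_compose2[OF _ continuous_on_minus[OF continuous_on_id]])
    thus ?thesis unfolding q_def by (intro continuous_intros)
  qed
  hence "bounded (q ` {0..1})"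
    by (intro compact_imp_bounded compact_continuous_image) auto
  then obtain M where "\<forall>t\<in>{0..1}. \<bar>q t\<bar> \<le> M" by (auto simp: bounded_iff)
  hence M: "q t \<le> M" if "t \<in> {0..1}" for t using that by fastforce
  have M0: "M \<ge> 0" using q0[of 0] M[of 0] by simp
  \<comment> \<open>The majorant \<open>4 * M * t\<^sup>2\<close> scales exactly like the doubling
    inequality, and its factor 4 makes it at least \<open>M\<close> from \<open>t = 1 / 2\<close>
    on.\<close>
  have large: "q t \<le> 4 * M * t\<^sup>2" if "1 / 2 \<le> t" "t \<le> 2 ^ k" for t k
    using that
  proof (induction k arbitrary: t)
    case 0
    have "(1 / 2)\<^sup>2 \<le> t\<^sup>2" using 0 by (intro power_mono) auto
    hence "1 \<le> 4 * t\<^sup>2" by (simp add: power2_eq_square)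
    hence "M * 1 \<le> M * (4 * t\<^sup>2)" using M0 by (intro mult_left_mono)
    thus ?case using M[of t] 0 by simp
  next
    case (Suc k)
    show ?case
    \<comment> \<open>Halving has to stay at or above 1/2, so it is used only beyond 1.\<close>
    proof (cases "t \<le> 1")
      case True
      have "(1 / 2)\<^sup>2 \<le> t\<^sup>2" using Suc.prems by (intro power_mono) auto
      hence "1 \<le> 4 * t\<^sup>2" by (simp add: power2_eq_square)
      hence "M * 1 \<le> M * (4 * t\<^sup>2)" using M0 by (intro mult_left_mono)
      thus ?thesis using M[of t] Suc.prems True by simp
    next
      case False
      hence "q (t / 2) \<le> 4 * M * (t / 2)\<^sup>2" using Suc.prems by (intro Suc.IH) auto
      thus ?thesis using double[of "t / 2"] by (simp add: power2_eq_square)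
    qed
  qed
  show ?thesis
  proof (rule that[of "4 * M"])
    fix t :: real assume t: "t \<ge> 0"
    show "norm (g t + g (- t)) \<le> 4 * M * (1 + t\<^sup>2)"
    proof (cases "t \<ge> 1 / 2")
      case True
      obtain k where "t < 2 ^ k" using real_arch_pow[of 2 t] by auto
      thus ?thesis using large[of t k] True M0 by (simp add: norm_q algebra_simps)
    next
      case False
      have "M * 1 \<le> M * (4 * (1 + t\<^sup>2))" using M0 by (intro mult_left_mono) auto
      thus ?thesis using M[of t] t False by (simp add: norm_q algebra_simps)
    qed
  qed
qed

section \<open>The coefficients of H and the two implications\<close>

definition zero_coeff :: "real \<Rightarrow> complex \<Rightarrow> complex" where
  "zero_coeff l \<rho> = of_int (zorder riemann_zeta \<rho>) / ((\<rho> - of_real l) * ((1 - \<rho>) - of_real l))"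

lemma H_exp_eq: "H l (exp t) = (\<Sum>\<^sub>\<infinity>\<rho>\<in>nontrivial_zeros. zero_coeff l \<rho> * exp ((\<rho> - 1 / 2) * of_real t))"
  unfolding H_def zero_coeff_def by (simp add: of_real_powr_eq_exp)

text \<open>As \<open>l\<close> is real, each factor of the denominator has norm at least
  \<open>\<bar>Im \<rho>\<bar>\<close>, uniformly in \<open>l\<close>; from height 1 on,
  \<open>1 + \<bar>Im \<rho>\<bar> \<le> 2 * \<bar>Im \<rho>\<bar>\<close> accounts for the
  4.\<close>

lemma norm_zero_coeff_le:
  assumes "\<rho> \<in> nontrivial_zeros" "\<bar>Im \<rho>\<bar> \<ge> 1"
  shows "norm (zero_coeff l \<rho>) \<le> 4 * (real_of_int (zorder riemann_zeta \<rho>) / (1 + \<bar>Im \<rho>\<bar>)\<^sup>2)"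
proof -
  have m: "real_of_int (zorder riemann_zeta \<rho>) \<ge> 0" using zorder_riemann_zeta(2)[OF assms(1)] by simp
  have "\<bar>Im \<rho>\<bar> * \<bar>Im \<rho>\<bar> \<le> norm (\<rho> - of_real l) * norm ((1 - \<rho>) - of_real l)"
    using abs_Im_le_cmod[of "\<rho> - of_real l"] abs_Im_le_cmod[of "(1 - \<rho>) - of_real l"]
    by (intro mult_mono) auto
  moreover have "(1 + \<bar>Im \<rho>\<bar>)\<^sup>2 \<le> (2 * \<bar>Im \<rho>\<bar>)\<^sup>2"
    using assms(2) by (intro power_mono) auto
  ultimately have "(1 + \<bar>Im \<rho>\<bar>)\<^sup>2 / 4 \<le> norm (\<rho> - of_real l) * norm ((1 - \<rho>) - of_real l)"
    by (simp add: power2_eq_square)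
  moreover have "(1 + \<bar>Im \<rho>\<bar>)\<^sup>2 / 4 > 0" by (simp add: add_pos_nonneg)
  ultimately have "real_of_int (zorder riemann_zeta \<rho>) / (norm (\<rho> - of_real l) * norm ((1 - \<rho>) - of_real l)) \<le>
      real_of_int (zorder riemann_zeta \<rho>) / ((1 + \<bar>Im \<rho>\<bar>)\<^sup>2 / 4)"
    using m by (intro divide_left_mono mult_pos_pos) (auto intro: less_le_trans)
  thus ?thesis using m by (simp add: zero_coeff_def norm_divide norm_mult mult.commute)
qed

lemma summable_zero_coeff: "(\<lambda>\<rho>. norm (zero_coeff l \<rho>)) summable_on nontrivial_zeros"
proof -
  let ?F = "{\<rho>\<in>nontrivial_zeros. \<bar>Im \<rho>\<bar> \<le> 1}"
  have "(\<lambda>\<rho>. 4 * (real_of_int (zorder riemann_zeta \<rho>) / (1 + \<bar>Im \<rho>\<bar>)\<^sup>2)) summable_on nontrivial_zeros - ?F"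
    by (rule summable_on_subset_banach[OF summable_on_cmult_right[OF summable_nontrivial_zeros]]) auto
  hence "(\<lambda>\<rho>. norm (zero_coeff l \<rho>)) summable_on nontrivial_zeros - ?F"
  proof (rule summable_on_comparison_test)
    show "norm (zero_coeff l \<rho>) \<le> 4 * (real_of_int (zorder riemann_zeta \<rho>) / (1 + \<bar>Im \<rho>\<bar>)\<^sup>2)"
      if "\<rho> \<in> nontrivial_zeros - ?F" for \<rho>
      using that by (intro norm_zero_coeff_le) auto
  qed simp
  moreover have "(\<lambda>\<rho>. norm (zero_coeff l \<rho>)) summable_on ?F"
    by (intro summable_on_finite finite_nontrivial_zeros)
  ultimately have "(\<lambda>\<rho>. norm (zero_coeff l \<rho>)) summable_on (nontrivial_zeros - ?F) \<union> ?F"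
    by (rule summable_on_union)
  moreover have "(nontrivial_zeros - ?F) \<union> ?F = nontrivial_zeros" by auto
  ultimately show ?thesis by simp
qed

lemma riemann_hypothesis_imp_screw_function:
  assumes riemann_hypothesis
  shows "screw_function (\<lambda>t. H l (exp t) - H l 1)"
proof -
  define a where "a = (\<lambda>\<rho>. norm (zero_coeff l \<rho>))"
  have term_eq: "zero_coeff l \<rho> * exp ((\<rho> - 1 / 2) * of_real t) = of_real (a \<rho>) * cis (Im \<rho> * t)"
    if \<rho>: "\<rho> \<in> nontrivial_zeros" for \<rho> t
  proof -
    have Re: "Re \<rho> = 1 / 2" using assms \<rho> by (simp add: riemann_hypothesis_def)
    \<comment> \<open>On the critical line \<open>1 - \<rho>\<close> is the conjugate of
      \<open>\<rho>\<close>, and \<open>l\<close> is real, so the denominator becomes a squared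
      norm.\<close>
    hence eq: "(1 - \<rho>) - of_real l = cnj (\<rho> - of_real l)" "\<rho> - 1 / 2 = \<i> * of_real (Im \<rho>)"
      by (auto simp: complex_eq_iff)
    have "zero_coeff l \<rho> = of_real (real_of_int (zorder riemann_zeta \<rho>) / (norm (\<rho> - of_real l))\<^sup>2)"
      "exp ((\<rho> - 1 / 2) * of_real t) = cis (Im \<rho> * t)"
      unfolding zero_coeff_def eq complex_norm_square[symmetric] by (simp_all add: cis_conv_exp mult_ac)
    thus ?thesis using zorder_riemann_zeta(2)[OF \<rho>] by (simp add: a_def norm_divide norm_power)
  qed
  have H_eq: "H l (exp t) = (\<Sum>\<^sub>\<infinity>\<rho>\<in>nontrivial_zeros. complex_of_real (a \<rho>) * cis (Im \<rho> * t))" for t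
    unfolding H_exp_eq by (intro infsum_cong term_eq)
  have "screw_function (\<lambda>t. (\<Sum>\<^sub>\<infinity>\<rho>\<in>nontrivial_zeros. complex_of_real (a \<rho>) * cis (Im \<rho> * t)) -
      (\<Sum>\<^sub>\<infinity>\<rho>\<in>nontrivial_zeros. complex_of_real (a \<rho>) * cis (Im \<rho> * 0)))"
    by (rule screw_function_cis_sum) (use summable_zero_coeff in \<open>auto simp: a_def\<close>)
  thus ?thesis unfolding H_eq[symmetric] by simp
qed

lemma screw_function_imp_riemann_hypothesis:
  assumes "screw_function (\<lambda>t. H l (exp t) - H l 1)"
  shows riemann_hypothesis
proof -
  \<comment> \<open>Centring at \<open>w = \<rho> - 1 / 2\<close> and extending by zero makes the
    reflection \<open>w\<close> to \<open>- w\<close> a bijection of the index set.\<close>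
  define d where "d = (\<lambda>w. if w + 1 / 2 \<in> nontrivial_zeros then zero_coeff l (w + 1 / 2) else 0)"
  define c where "c = (\<lambda>w. d w + d (- w))"
  have bij: "bij_betw (\<lambda>w. w + 1 / 2) UNIV (UNIV :: complex set)"
    by (rule bij_betwI[of _ _ _ "\<lambda>w. w - 1 / 2"]) auto
  have d_Re: "\<bar>Re w\<bar> \<le> 1 / 2" if "d w \<noteq> 0" for w
    using that by (auto simp: d_def nontrivial_zeros_def abs_le_iff split: if_splits)
  have "(\<lambda>\<rho>. if \<rho> \<in> nontrivial_zeros then norm (zero_coeff l \<rho>) else 0) summable_on UNIV"
    by (rule summable_on_cong_neutral[THEN iffD1, OF _ _ _ summable_zero_coeff]) auto
  hence "(\<lambda>w. if w + 1 / 2 \<in> nontrivial_zeros then norm (zero_coeff l (w + 1 / 2)) else 0) summable_on UNIV"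
    by (subst summable_on_reindex_bij_betw[OF bij])
  hence d_sum: "(\<lambda>w. norm (d w)) summable_on UNIV"
    by (rule summable_on_cong[THEN iffD1, rotated]) (auto simp: d_def)
  have H_eq: "H l (exp t) = exp_sum d t" for t
  proof -
    let ?f = "\<lambda>\<rho>. if \<rho> \<in> nontrivial_zeros then zero_coeff l \<rho> * exp ((\<rho> - 1 / 2) * of_real t) else 0"
    have "H l (exp t) = (\<Sum>\<^sub>\<infinity>\<rho>. ?f \<rho>)"
      unfolding H_exp_eq by (rule infsum_cong_neutral) auto
    also have "\<dots> = (\<Sum>\<^sub>\<infinity>w. ?f (w + 1 / 2))"
      by (rule infsum_reindex_bij_betw[OF bij, symmetric])
    also have "\<dots> = exp_sum d t"
      unfolding exp_sum_def by (intro infsum_cong) (auto simp: d_def)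
    finally show ?thesis .
  qed
  have d_exp: "(\<lambda>w. d w * exp (w * of_real t)) summable_on UNIV" for t
  proof (rule abs_summable_summable, rule summable_on_comparison_test)
    show "(\<lambda>w. norm (d w) * exp (\<bar>t\<bar> / 2)) summable_on UNIV"
      by (rule summable_on_cmult_left[OF d_sum])
    fix w
    show "norm (d w * exp (w * of_real t)) \<le> norm (d w) * exp (\<bar>t\<bar> / 2)"
    proof (cases "d w = 0")
      case False
      have "Re w * t \<le> \<bar>Re w\<bar> * \<bar>t\<bar>" by (metis abs_ge_self abs_mult)
      also have "\<dots> \<le> 1 / 2 * \<bar>t\<bar>" using d_Re[OF False] by (intro mult_right_mono) auto
      finally show ?thesis by (simp add: norm_mult mult_left_mono)
    qed simp
  qed auto
  have bij_neg: "bij_betw uminus UNIV (UNIV :: complex set)"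
    by (rule bij_betwI[of _ _ _ uminus]) auto
  have c_eq: "exp_sum c t = exp_sum d t + exp_sum d (- t)" for t
  proof -
    have neg: "(\<lambda>w. d (- w) * exp (w * of_real t)) = (\<lambda>w. (\<lambda>w. d w * exp (w * of_real (- t))) (- w))"
      by simp
    have "exp_sum c t = (\<Sum>\<^sub>\<infinity>w. d w * exp (w * of_real t) + d (- w) * exp (w * of_real t))"
      by (simp add: exp_sum_def c_def algebra_simps)
    also have "\<dots> = exp_sum d t + (\<Sum>\<^sub>\<infinity>w. d (- w) * exp (w * of_real t))"
      unfolding exp_sum_def
    proof (rule infsum_add[OF d_exp])
      show "(\<lambda>w. d (- w) * exp (w * of_real t)) summable_on UNIV"
        unfolding neg by (subst summable_on_reindex_bij_betw[OF bij_neg]) (rule d_exp)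
    qed
    also have "(\<Sum>\<^sub>\<infinity>w. d (- w) * exp (w * of_real t)) = exp_sum d (- t)"
      unfolding neg exp_sum_def by (rule infsum_reindex_bij_betw[OF bij_neg])
    finally show ?thesis .
  qed
  have c_sum: "(\<lambda>w. norm (c w)) summable_on UNIV"
  proof (rule summable_on_comparison_test)
    have "(\<lambda>w. norm (d (- w))) summable_on UNIV"
      using d_sum summable_on_reindex_bij_betw[OF bij_neg, of "\<lambda>w. norm (d w)"] by simp
    thus "(\<lambda>w. norm (d w) + norm (d (- w))) summable_on UNIV"
      by (rule summable_on_add[OF d_sum])
  qed (auto simp: c_def norm_triangle_ineq)
  have c_Re: "Re w \<le> 1 / 2" if "c w \<noteq> 0" for w
    using that d_Re[of w] d_Re[of "- w"] by (cases "d w = 0") (auto simp: c_def)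
  have c_fin: "finite {w. c w \<noteq> 0 \<and> norm w \<le> R}" for R
  proof (rule finite_subset)
    let ?F = "{\<rho>\<in>nontrivial_zeros. \<bar>Im \<rho>\<bar> \<le> R}"
    show "finite ((\<lambda>\<rho>. \<rho> - 1 / 2) ` ?F \<union> (\<lambda>\<rho>. 1 / 2 - \<rho>) ` ?F)"
      using finite_nontrivial_zeros by blast
    show "{w. c w \<noteq> 0 \<and> norm w \<le> R} \<subseteq> (\<lambda>\<rho>. \<rho> - 1 / 2) ` ?F \<union> (\<lambda>\<rho>. 1 / 2 - \<rho>) ` ?F"
    proof
      fix w assume w: "w \<in> {w. c w \<noteq> 0 \<and> norm w \<le> R}"
      hence Im: "\<bar>Im w\<bar> \<le> R" using abs_Im_le_cmod[of w] by auto
      from w have "d w \<noteq> 0 \<or> d (- w) \<noteq> 0" by (auto simp: c_def)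
      then consider "d w \<noteq> 0" | "d (- w) \<noteq> 0" by argo
      thus "w \<in> (\<lambda>\<rho>. \<rho> - 1 / 2) ` ?F \<union> (\<lambda>\<rho>. 1 / 2 - \<rho>) ` ?F"
      proof cases
        case 1
        hence "w + 1 / 2 \<in> ?F" using Im by (auto simp: d_def split: if_splits)
        thus ?thesis by (intro UnI1 image_eqI[of _ _ "w + 1 / 2"]) auto
      next
        case 2
        hence "- w + 1 / 2 \<in> ?F" using Im by (auto simp: d_def split: if_splits)
        thus ?thesis by (intro UnI2 image_eqI[of _ _ "- w + 1 / 2"]) auto
      qed
    qed
  qed
  obtain M where M: "\<And>t. t \<ge> 0 \<Longrightarrow> norm ((H l (exp t) - H l 1) + (H l (exp (- t)) - H l 1)) \<le> M * (1 + t\<^sup>2)"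
  proof (rule screw_function_growth[OF assms])
    fix M
    assume "\<And>t. t \<ge> 0 \<Longrightarrow> norm ((H l (exp t) - H l 1) + (H l (exp (- t)) - H l 1)) \<le> M * (1 + t\<^sup>2)"
    thus thesis by (rule that)
  qed simp
  have growth: "\<exists>B. \<forall>t\<ge>0. norm (exp_sum c t) \<le> B * exp (\<epsilon> * t)" if \<epsilon>: "\<epsilon> > 0" for \<epsilon>
  proof (intro exI allI impI)
    fix t :: real assume t: "t \<ge> 0"
    have M0: "M \<ge> 0" using M[of 0] by simp
    \<comment> \<open>Undoing the normalisation at \<open>t = 0\<close> adds the constant
      \<open>2 * H l 1\<close>, which any rate \<open>\<epsilon> > 0\<close> absorbs.\<close>
    have "exp_sum c t = ((H l (exp t) - H l 1) + (H l (exp (- t)) - H l 1)) + 2 * H l 1"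
      by (simp add: c_eq H_eq)
    hence "norm (exp_sum c t) \<le> M * (1 + t\<^sup>2) + 2 * norm (H l 1)"
      using M[OF t] norm_triangle_ineq[of "(H l (exp t) - H l 1) + (H l (exp (- t)) - H l 1)" "2 * H l 1"]
      by (simp add: norm_mult)
    moreover have "1 + t\<^sup>2 \<le> (1 + 2 / \<epsilon>\<^sup>2) * exp (\<epsilon> * t)"
    proof -
      \<comment> \<open>The quadratic Taylor term of the exponential dominates
        \<open>t\<^sup>2\<close> at the price of the factor
        \<open>2 / \<epsilon>\<^sup>2\<close>.\<close>
      have "1 + \<epsilon> * t + (\<epsilon> * t)\<^sup>2 / 2 \<le> exp (\<epsilon> * t)"
        using \<epsilon> t by (intro exp_lower_Taylor_quadratic) auto
      hence "(\<epsilon> * t)\<^sup>2 / 2 \<le> exp (\<epsilon> * t)" using \<epsilon> t mult_nonneg_nonneg[of \<epsilon> t] by linarith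
      hence "t\<^sup>2 \<le> 2 / \<epsilon>\<^sup>2 * exp (\<epsilon> * t)" using \<epsilon> by (simp add: field_simps power_mult_distrib)
      moreover have "1 \<le> exp (\<epsilon> * t)" using \<epsilon> t by simp
      ultimately have "1 + t\<^sup>2 \<le> exp (\<epsilon> * t) + 2 / \<epsilon>\<^sup>2 * exp (\<epsilon> * t)"
        by (intro add_mono)
      thus ?thesis by (simp only: distrib_right mult_1)
    qed
    hence "M * (1 + t\<^sup>2) \<le> M * ((1 + 2 / \<epsilon>\<^sup>2) * exp (\<epsilon> * t))" using M0 by (rule mult_left_mono)
    moreover have "2 * norm (H l 1) * 1 \<le> 2 * norm (H l 1) * exp (\<epsilon> * t)"
      using \<epsilon> t by (intro mult_left_mono) auto
    ultimately show "norm (exp_sum c t) \<le> (M * (1 + 2 / \<epsilon>\<^sup>2) + 2 * norm (H l 1)) * exp (\<epsilon> * t)"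
      by (simp add: algebra_simps)
  qed
  show ?thesis
    unfolding riemann_hypothesis_def
  proof
    fix \<rho> assume \<rho>: "\<rho> \<in> nontrivial_zeros"
    define w where "w = \<rho> - 1 / 2"
    define D where "D = (\<rho> - of_real l) * ((1 - \<rho>) - of_real l)"
    \<comment> \<open>Multiplicity extended by zero, so that it also has a nonnegative value at the
      reflected point \<open>1 - \<rho>\<close>.\<close>
    define m where "m = (\<lambda>\<rho>. if \<rho> \<in> nontrivial_zeros then real_of_int (zorder riemann_zeta \<rho>) else 0)"
    have "\<rho> \<noteq> of_real l" using \<rho> real_nontrivial_zero_False[of l] by auto
    moreover have "1 - \<rho> \<noteq> of_real l"
    proof
      assume "1 - \<rho> = of_real l"
      hence "\<rho> = of_real (1 - l)" by (simp add: algebra_simps)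
      thus False using \<rho> real_nontrivial_zero_False[of "1 - l"] by simp
    qed
    ultimately have "D \<noteq> 0" by (simp add: D_def)
    \<comment> \<open>The value at \<open>- w\<close> belongs to \<open>1 - \<rho>\<close>, whose
      denominator has the same two factors in exchanged order.\<close>
    have "d w = of_real (m \<rho>) / D" "d (- w) = of_real (m (1 - \<rho>)) / D"
      by (auto simp: d_def w_def m_def D_def zero_coeff_def mult.commute)
    hence "c w = of_real (m \<rho> + m (1 - \<rho>)) / D" by (simp add: c_def add_divide_distrib)
    moreover have "m \<rho> > 0" "m (1 - \<rho>) \<ge> 0"
      using \<rho> zorder_riemann_zeta(2) by (auto simp: m_def intro: less_imp_le)
    ultimately have "c w \<noteq> 0" using \<open>D \<noteq> 0\<close> by (simp del: of_real_add)
    \<comment> \<open>By evenness both \<open>w\<close> and \<open>- w\<close> are exponents, and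
      the two inequalities together give \<open>Re w = 0\<close>.\<close>
    moreover have "c (- w) = c w" by (simp add: c_def)
    ultimately have "Re w \<le> 0" "Re (- w) \<le> 0"
      by (auto intro!: exp_sum_exponents_le_0[OF c_sum c_Re c_fin growth] simp del: uminus_complex.sel)
    thus "Re \<rho> = 1 / 2" by (simp add: w_def)
  qed
qed

theorem corollary4p1:
  fixes l :: real
  shows "screw_function (\<lambda>t. H l (exp t) - H l 1) \<longleftrightarrow> riemann_hypothesis"
  using riemann_hypothesis_imp_screw_function screw_function_imp_riemann_hypothesis by blast

end
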